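(* Let $\downarrow^{\mathrm{eq}}$ be an independence relation on $\mathfrak C^{\mathrm{eq}}$ extending $\downarrow$, and let $M_P=\langle M,P(M)\rangle$ be a small model of $T^2$ with $P(M)$ closed in $M$. If $M_P$ satisfies the Extension Property (for $\mathcal L$-1-types), then it satisfies the Extension Property for imaginary tuples: that is, if $\bar c$ and $\bar a$ are very small tuples in $M^{\mathrm{eq}}$, then there exists a tuple $\bar c'$ in $M^{\mathrm{eq}}$ such that $\bar c'\equiv^1_{\bar a}\bar c$ and $\bar c'\downarrow^{\mathrm{eq}}_{\bar a}P(M)$.
   Context: $T$ is a complete first-order theory in a language $\mathcal L$ and $\mathfrak C$ is a monster model of $T$; "small" means of cardinality smaller than the monstrosity of $\mathfrak C$ (its degree of saturation and strong homogeneity); tuples have small length. Juxtaposition denotes union, and tuples are identified with their sets of entries. An independence relation on $\mathfrak C$ is a ternary relation $A\downarrow_C B$ on small subsets of $\mathfrak C$ such that for all small $A,B,C,D$: (Invariance) $A\downarrow_B C\Rightarrow\sigma(A)\downarrow_{\sigma(B)}\sigma(C)$ for $\sigma\in\mathrm{Aut}(\mathfrak C)$; (Normality) $A\downarrow_C B\Rightarrow AC\downarrow_C B$; (Symmetry) $A\downarrow_B C\Rightarrow C\downarrow_B A$; (Transitivity) if $B\subseteq C\subseteq D$, then $A\downarrow_B D$ iff $A\downarrow_B C$ and $A\downarrow_C D$; (Finite character) $A\downarrow_B C$ iff $A_0\downarrow_B C$ for all finite $A_0\subseteq A$; (Extension) there is $A'\equiv_B A$ with $A'\downarrow_B C$;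 (Local character) there is a small cardinal $\lambda$ depending only on $\downarrow$ such that for all small $A,C$ there is $C_0\subseteq C$ with $|C_0|<\lambda+|A|^+$ and $A\downarrow_{C_0}C$. Independence relations on $\mathfrak C^{\mathrm{eq}}$ are defined in the same way. Fix an independence relation $\downarrow$ on $\mathfrak C$. $\kappa_0$ is the least regular cardinal $\mu$ such that for every finite tuple $\bar a$ and small set $B$ there is $B_0\subseteq B$ with $|B_0|<\mu$ and $\bar a\downarrow_{B_0}B$. $\mathrm{cl}(A)=\{c\in\mathfrak C:c\downarrow_A c\}$. $\mathcal L^2=\mathcal L\cup\{P\}$ with $P$ a new unary predicate; $T^2$ is the theory of all expansions of $T$ to $\mathcal L^2$. A superscript 1 on a model-theoretic notion refers to $\mathcal L$; $S^1_1(A)$ is the set of complete $\mathcal L$-types over $A$ in one variable. Models of $T$ are elementary substructures of $\mathfrak C$; a model of $T^2$ is written $M_P=\langle M,P(M)\rangle$. $P(M)$ is closed in $M$ if $\mathrm{cl}(P(M))\cap M=P(M)$. Fix a small cardinal $\kappa>\max(\kappa_0,|T|)$; a set or tuple is very small if its cardinality is $<\kappa$. Extension Property (for $\mathcal L$-1-types): for every very small $A\subset M$ and $q\in S^1_1(A)$ there is $b\in M$ realizing $q$ with $b\downarrow_A P(M)$. *)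

theory Defs
  imports Main
begin

unbundle cardinal_syntax

section \<open>Many-sorted first-order logic\<close>

text \<open>
  Logic is set up many-sorted so that the notions of type, automorphism and independence relation
  apply verbatim both to a one-sorted structure (sort type \<^typ>\<open>unit\<close>) and to its imaginary expansion.
  A variable is a pair (sort, index).
\<close>

record ('f, 'r, 's) lang =
  sorts :: "'s set"
  funs :: "'f set"
  fdom :: "'f \<Rightarrow> 's list"
  fcod :: "'f \<Rightarrow> 's"
  rels :: "'r set"
  rdom :: "'r \<Rightarrow> 's list"

datatype ('f, 's) trm = Var 's nat | Fn 'f "('f, 's) trm list"

datatype ('f, 'r, 's) fm =
    Eq "('f, 's) trm" "('f, 's) trm"
  | Rel 'r "('f, 's) trm list"
  | Neg "('f, 'r, 's) fm"
  | Conj "('f, 'r, 's) fm" "('f, 'r, 's) fm"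
  | Ex 's nat "('f, 'r, 's) fm"

primrec sort_of :: "('f, 'r, 's) lang \<Rightarrow> ('f, 's) trm \<Rightarrow> 's" where
  "sort_of L (Var s n) = s"
| "sort_of L (Fn f ts) = fcod L f"

primrec wf_trm :: "('f, 'r, 's) lang \<Rightarrow> ('f, 's) trm \<Rightarrow> bool" where
  "wf_trm L (Var s n) \<longleftrightarrow> s \<in> sorts L"
| "wf_trm L (Fn f ts) \<longleftrightarrow>
     f \<in> funs L \<and> map (sort_of L) ts = fdom L f \<and> (\<forall>b\<in>set (map (wf_trm L) ts). b)"

primrec wf_fm :: "('f, 'r, 's) lang \<Rightarrow> ('f, 'r, 's) fm \<Rightarrow> bool" where
  "wf_fm L (Eq t u) \<longleftrightarrow> wf_trm L t \<and> wf_trm L u \<and> sort_of L t = sort_of L u"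
| "wf_fm L (Rel r ts) \<longleftrightarrow>
     r \<in> rels L \<and> map (sort_of L) ts = rdom L r \<and> (\<forall>t\<in>set ts. wf_trm L t)"
| "wf_fm L (Neg \<phi>) \<longleftrightarrow> wf_fm L \<phi>"
| "wf_fm L (Conj \<phi> \<psi>) \<longleftrightarrow> wf_fm L \<phi> \<and> wf_fm L \<psi>"
| "wf_fm L (Ex s n \<phi>) \<longleftrightarrow> s \<in> sorts L \<and> wf_fm L \<phi>"

primrec fv_trm :: "('f, 's) trm \<Rightarrow> ('s \<times> nat) set" where
  "fv_trm (Var s n) = {(s, n)}"
| "fv_trm (Fn f ts) = \<Union>(set (map fv_trm ts))"

primrec fv :: "('f, 'r, 's) fm \<Rightarrow> ('s \<times> nat) set" where
  "fv (Eq t u) = fv_trm t \<union> fv_trm u"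
| "fv (Rel r ts) = \<Union>(fv_trm ` set ts)"
| "fv (Neg \<phi>) = fv \<phi>"
| "fv (Conj \<phi> \<psi>) = fv \<phi> \<union> fv \<psi>"
| "fv (Ex s n \<phi>) = fv \<phi> - {(s, n)}"

definition sentences :: "('f, 'r, 's) lang \<Rightarrow> ('f, 'r, 's) fm set" where
  "sentences L = {\<phi>. wf_fm L \<phi> \<and> fv \<phi> = {}}"

record ('f, 'r, 's, 'e) struct =
  univ :: "'s \<Rightarrow> 'e set"
  fint :: "'f \<Rightarrow> 'e list \<Rightarrow> 'e"
  rint :: "'r \<Rightarrow> 'e list \<Rightarrow> bool"

definition points :: "('f, 'r, 's, 'e) struct \<Rightarrow> 'e set" where
  "points M = (\<Union>s. univ M s)"

definition is_struct :: "('f, 'r, 's) lang \<Rightarrow> ('f, 'r, 's, 'e) struct \<Rightarrow> bool" where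
  "is_struct L M \<longleftrightarrow>
     (\<forall>s. univ M s \<noteq> {} \<longleftrightarrow> s \<in> sorts L) \<and>
     (\<forall>s s'. s \<noteq> s' \<longrightarrow> univ M s \<inter> univ M s' = {}) \<and>
     (\<forall>f\<in>funs L. \<forall>xs. list_all2 (\<lambda>x s. x \<in> univ M s) xs (fdom L f) \<longrightarrow>
        fint M f xs \<in> univ M (fcod L f))"

primrec eval_trm :: "('f, 'r, 's, 'e) struct \<Rightarrow> ('s \<times> nat \<Rightarrow> 'e) \<Rightarrow> ('f, 's) trm \<Rightarrow> 'e" where
  "eval_trm M \<rho> (Var s n) = \<rho> (s, n)"
| "eval_trm M \<rho> (Fn f ts) = fint M f (map (eval_trm M \<rho>) ts)"

primrec sat :: "('f, 'r, 's, 'e) struct \<Rightarrow> ('s \<times> nat \<Rightarrow> 'e) \<Rightarrow> ('f, 'r, 's) fm \<Rightarrow> bool" where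
  "sat M \<rho> (Eq t u) \<longleftrightarrow> eval_trm M \<rho> t = eval_trm M \<rho> u"
| "sat M \<rho> (Rel r ts) \<longleftrightarrow> rint M r (map (eval_trm M \<rho>) ts)"
| "sat M \<rho> (Neg \<phi>) \<longleftrightarrow> \<not> sat M \<rho> \<phi>"
| "sat M \<rho> (Conj \<phi> \<psi>) \<longleftrightarrow> sat M \<rho> \<phi> \<and> sat M \<rho> \<psi>"
| "sat M \<rho> (Ex s n \<phi>) \<longleftrightarrow> (\<exists>e\<in>univ M s. sat M (\<rho>((s, n) := e)) \<phi>)"

definition models :: "('f, 'r, 's, 'e) struct \<Rightarrow> ('f, 'r, 's) fm set \<Rightarrow> bool" where
  "models M T \<longleftrightarrow> (\<forall>\<phi>\<in>T. \<forall>\<rho>. sat M \<rho> \<phi>)"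

text \<open>
  A complete theory is taken to be deductively closed, i.e. it decides every sentence by membership;
  hence its cardinality is the number of \<open>L\<close>-formulas, the usual meaning of \<open>|T|\<close>.
  Consistency is not part of the definition; it comes from having a model.
\<close>

definition complete_theory :: "('f, 'r, 's) lang \<Rightarrow> ('f, 'r, 's) fm set \<Rightarrow> bool" where
  "complete_theory L T \<longleftrightarrow>
     T \<subseteq> sentences L \<and> (\<forall>\<phi>\<in>sentences L. \<phi> \<in> T \<longleftrightarrow> Neg \<phi> \<notin> T)"

definition elementary_substructure ::
  "('f, 'r, 's) lang \<Rightarrow> ('f, 'r, 's, 'e) struct \<Rightarrow> ('f, 'r, 's, 'e) struct \<Rightarrow> bool" where
  "elementary_substructure L M N \<longleftrightarrow>
     is_struct L M \<and> is_struct L N \<and> (\<forall>s. univ M s \<subseteq> univ N s) \<and>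
     (\<forall>f\<in>funs L. \<forall>xs. list_all2 (\<lambda>x s. x \<in> univ M s) xs (fdom L f) \<longrightarrow>
        fint M f xs = fint N f xs) \<and>
     (\<forall>r\<in>rels L. \<forall>xs. list_all2 (\<lambda>x s. x \<in> univ M s) xs (rdom L r) \<longrightarrow>
        rint M r xs = rint N r xs) \<and>
     (\<forall>\<phi> \<rho>. wf_fm L \<phi> \<and> (\<forall>(s, n)\<in>fv \<phi>. \<rho> (s, n) \<in> univ M s) \<longrightarrow>
        (sat M \<rho> \<phi> \<longleftrightarrow> sat N \<rho> \<phi>))"

definition automorphism ::
  "('f, 'r, 's) lang \<Rightarrow> ('f, 'r, 's, 'e) struct \<Rightarrow> ('e \<Rightarrow> 'e) \<Rightarrow> bool" where
  "automorphism L M \<sigma> \<longleftrightarrow>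
     (\<forall>s. bij_betw \<sigma> (univ M s) (univ M s)) \<and>
     (\<forall>f\<in>funs L. \<forall>xs. list_all2 (\<lambda>x s. x \<in> univ M s) xs (fdom L f) \<longrightarrow>
        \<sigma> (fint M f xs) = fint M f (map \<sigma> xs)) \<and>
     (\<forall>r\<in>rels L. \<forall>xs. list_all2 (\<lambda>x s. x \<in> univ M s) xs (rdom L r) \<longrightarrow>
        rint M r (map \<sigma> xs) = rint M r xs)"

section \<open>Types\<close>

text \<open>
  A formula over \<open>A\<close> is an \<open>L\<close>-formula together with a map \<open>v\<close> that renames each of its free
  variables to an index (\<open>Inl i\<close>) or substitutes a parameter from \<open>A\<close> for it (\<open>Inr a\<close>).
  Here \<open>X s\<close> is the set of indices of sort \<open>s\<close>. Values of \<open>v\<close> off the free variables are immaterial.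
\<close>

definition fms_over :: "('f, 'r, 's) lang \<Rightarrow> ('f, 'r, 's, 'e) struct \<Rightarrow> ('s \<Rightarrow> 'i set) \<Rightarrow> 'e set
    \<Rightarrow> (('f, 'r, 's) fm \<times> ('s \<times> nat \<Rightarrow> 'i + 'e)) set" where
  "fms_over L M X A =
     {(\<phi>, v). wf_fm L \<phi> \<and> (\<forall>(s, n)\<in>fv \<phi>. v (s, n) \<in> X s <+> (A \<inter> univ M s))}"

definition sat_over :: "('f, 'r, 's, 'e) struct \<Rightarrow> ('i \<Rightarrow> 'e)
    \<Rightarrow> ('f, 'r, 's) fm \<times> ('s \<times> nat \<Rightarrow> 'i + 'e) \<Rightarrow> bool" where
  "sat_over M a p \<longleftrightarrow> sat M (case_sum a id \<circ> snd p) (fst p)"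

text \<open>
  The type over \<open>B\<close> of the tuple \<open>a\<close> indexed by \<open>I\<close>. It also records the sorts of the entries,
  through the formulas that occur in it.
\<close>

definition tp :: "('f, 'r, 's) lang \<Rightarrow> ('f, 'r, 's, 'e) struct \<Rightarrow> 'e set \<Rightarrow> 'i set \<Rightarrow> ('i \<Rightarrow> 'e)
    \<Rightarrow> (('f, 'r, 's) fm \<times> ('s \<times> nat \<Rightarrow> 'i + 'e)) set" where
  "tp L M B I a = {p \<in> fms_over L M (\<lambda>s. {i \<in> I. a i \<in> univ M s}) B. sat_over M a p}"

text \<open>Complete types over \<open>A\<close> in one variable, of sort \<open>s\<close>.\<close>

definition S1 :: "('f, 'r, 's) lang \<Rightarrow> ('f, 'r, 's, 'e) struct \<Rightarrow> 's \<Rightarrow> 'e set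
    \<Rightarrow> (('f, 'r, 's) fm \<times> ('s \<times> nat \<Rightarrow> unit + 'e)) set set" where
  "S1 L M s A =
     (let F = fms_over L M (\<lambda>s'. if s' = s then {()} else {}) A
      in {q. q \<subseteq> F \<and>
             (\<forall>q0\<subseteq>q. finite q0 \<longrightarrow> (\<exists>b\<in>univ M s. \<forall>p\<in>q0. sat_over M (\<lambda>_. b) p)) \<and>
             (\<forall>(\<phi>, v)\<in>F. (\<phi>, v) \<in> q \<or> (Neg \<phi>, v) \<in> q)})"

definition realizes :: "('f, 'r, 's, 'e) struct \<Rightarrow> 'e
    \<Rightarrow> (('f, 'r, 's) fm \<times> ('s \<times> nat \<Rightarrow> unit + 'e)) set \<Rightarrow> bool" where
  "realizes M b q \<longleftrightarrow> (\<forall>p\<in>q. sat_over M (\<lambda>_. b) p)"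

section \<open>Monster models and independence relations\<close>

text \<open>
  The monstrosity \<open>kbar\<close> is a cardinal given as a cardinal order on an arbitrary type \<open>'k\<close>.
  A set \<open>A\<close> is small if \<open>|A| <o kbar\<close>. Every smaller cardinal has a copy on \<open>'k\<close>,
  so quantifying over \<^emph>\<open>small cardinals\<close> amounts to quantifying over \<open>'k rel\<close>.
\<close>

definition small_subset :: "'k rel \<Rightarrow> ('f, 'r, 's, 'e) struct \<Rightarrow> 'e set \<Rightarrow> bool" where
  "small_subset kbar M A \<longleftrightarrow> A \<subseteq> points M \<and> |A| <o kbar"

definition saturated ::
  "('f, 'r, 's) lang \<Rightarrow> ('f, 'r, 's, 'e) struct \<Rightarrow> 'k rel \<Rightarrow> bool" where
  "saturated L M kbar \<longleftrightarrow>
     (\<forall>A s. small_subset kbar M A \<and> s \<in> sorts L \<longrightarrow>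
        (\<forall>q\<in>S1 L M s A. \<exists>b\<in>univ M s. realizes M b q))"

definition strongly_homogeneous ::
  "('f, 'r, 's) lang \<Rightarrow> ('f, 'r, 's, 'e) struct \<Rightarrow> 'k rel \<Rightarrow> bool" where
  "strongly_homogeneous L M kbar \<longleftrightarrow>
     (\<forall>A g. small_subset kbar M A \<and> g ` A \<subseteq> points M \<and> tp L M {} A id = tp L M {} A g \<longrightarrow>
        (\<exists>\<sigma>. automorphism L M \<sigma> \<and> (\<forall>x\<in>A. \<sigma> x = g x)))"

definition monster :: "('f, 'r, 's) lang \<Rightarrow> ('f, 'r, 's, 'e) struct \<Rightarrow> 'k rel \<Rightarrow> bool" where
  "monster L M kbar \<longleftrightarrow>
     is_struct L M \<and> Card_order kbar \<and> saturated L M kbar \<and> strongly_homogeneous L M kbar"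

text \<open>
  An independence relation is a predicate \<open>ind\<close>, where \<open>ind A C B\<close> stands for
  \<open>A\<close> independent from \<open>B\<close> over \<open>C\<close> (base in the middle). Only its values on small subsets matter.
  In the extension axiom, \<open>A'\<close> is \<open>g ` A\<close>, enumerated along \<open>A\<close>.
\<close>

definition independence_relation :: "('f, 'r, 's) lang \<Rightarrow> ('f, 'r, 's, 'e) struct \<Rightarrow> 'k rel
    \<Rightarrow> ('e set \<Rightarrow> 'e set \<Rightarrow> 'e set \<Rightarrow> bool) \<Rightarrow> bool" where
  "independence_relation L M kbar ind \<longleftrightarrow>
     (let small = small_subset kbar M in
      \<comment> \<open>invariance\<close>
      (\<forall>A B C \<sigma>. small A \<and> small B \<and> small C \<and> automorphism L M \<sigma> \<and> ind A B C \<longrightarrow>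
         ind (\<sigma> ` A) (\<sigma> ` B) (\<sigma> ` C)) \<and>
      \<comment> \<open>normality\<close>
      (\<forall>A B C. small A \<and> small B \<and> small C \<and> ind A C B \<longrightarrow> ind (A \<union> C) C B) \<and>
      \<comment> \<open>symmetry\<close>
      (\<forall>A B C. small A \<and> small B \<and> small C \<and> ind A B C \<longrightarrow> ind C B A) \<and>
      \<comment> \<open>transitivity\<close>
      (\<forall>A B C D. small A \<and> small B \<and> small C \<and> small D \<and> B \<subseteq> C \<and> C \<subseteq> D \<longrightarrow>
         (ind A B D \<longleftrightarrow> ind A B C \<and> ind A C D)) \<and>
      \<comment> \<open>finite character\<close>
      (\<forall>A B C. small A \<and> small B \<and> small C \<longrightarrow>
         (ind A B C \<longleftrightarrow> (\<forall>A0\<subseteq>A. finite A0 \<longrightarrow> ind A0 B C))) \<and>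
      \<comment> \<open>extension\<close>
      (\<forall>A B C. small A \<and> small B \<and> small C \<longrightarrow>
         (\<exists>g. g ` A \<subseteq> points M \<and> tp L M B A g = tp L M B A id \<and> ind (g ` A) B C)) \<and>
      \<comment> \<open>local character\<close>
      (\<exists>lam :: 'k rel. Card_order lam \<and> lam <o kbar \<and>
         (\<forall>A C. small A \<and> small C \<longrightarrow>
            (\<exists>C0\<subseteq>C. |C0| <o lam +c cardSuc |A| \<and> ind A C0 C))))"

definition local_char_bound :: "('f, 'r, 's, 'e) struct \<Rightarrow> 'k rel
    \<Rightarrow> ('e set \<Rightarrow> 'e set \<Rightarrow> 'e set \<Rightarrow> bool) \<Rightarrow> 'k rel \<Rightarrow> bool" where
  "local_char_bound M kbar ind \<mu> \<longleftrightarrow>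
     (\<forall>A B. finite A \<and> A \<subseteq> points M \<and> small_subset kbar M B \<longrightarrow>
        (\<exists>B0\<subseteq>B. |B0| <o \<mu> \<and> ind A B0 B))"

definition is_kappa0 :: "('f, 'r, 's, 'e) struct \<Rightarrow> 'k rel
    \<Rightarrow> ('e set \<Rightarrow> 'e set \<Rightarrow> 'e set \<Rightarrow> bool) \<Rightarrow> 'k rel \<Rightarrow> bool" where
  "is_kappa0 M kbar ind k0 \<longleftrightarrow>
     Cinfinite k0 \<and> regularCard k0 \<and> local_char_bound M kbar ind k0 \<and>
     (\<forall>\<mu> :: 'k rel. Cinfinite \<mu> \<and> regularCard \<mu> \<and> local_char_bound M kbar ind \<mu> \<longrightarrow> k0 \<le>o \<mu>)"

definition cl :: "('f, 'r, 's, 'e) struct \<Rightarrow> ('e set \<Rightarrow> 'e set \<Rightarrow> 'e set \<Rightarrow> bool)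
    \<Rightarrow> 'e set \<Rightarrow> 'e set" where
  "cl M ind A = {c \<in> points M. ind {c} A {c}}"

section \<open>Imaginaries\<close>

text \<open>
  For a one-sorted \<open>M\<close>, the imaginary expansion has the home sort and, for every \<open>n > 0\<close> and every
  0-definable equivalence relation \<open>E\<close> on \<open>n\<close>-tuples, a sort \<open>Quot n E\<close> with the projection
  \<open>Proj n E\<close> onto it. Sorts are indexed by relations rather than by the formulas defining them.
  The class is tagged with its sort in order to keep the sorts disjoint.
\<close>

datatype 'e eqsort = Home | Quot nat "('e list \<times> 'e list) set"
datatype 'e eqpoint = Real (the_real: 'e) | Class nat "('e list \<times> 'e list) set" "'e list set"
datatype ('f, 'e) eqfun = Old 'f | Proj nat "('e list \<times> 'e list) set"

definition tuples :: "('f, 'r, unit, 'e) struct \<Rightarrow> nat \<Rightarrow> 'e list set" where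
  "tuples M n = {xs. length xs = n \<and> set xs \<subseteq> points M}"

definition def_equiv :: "('f, 'r, unit) lang \<Rightarrow> ('f, 'r, unit, 'e) struct \<Rightarrow> nat
    \<Rightarrow> ('e list \<times> 'e list) set \<Rightarrow> bool" where
  "def_equiv L M n E \<longleftrightarrow>
     n > 0 \<and> equiv (tuples M n) E \<and>
     (\<exists>\<phi>. wf_fm L \<phi> \<and> fv \<phi> \<subseteq> {((), i) | i. i < 2 * n} \<and>
        (\<forall>xs\<in>tuples M n. \<forall>ys\<in>tuples M n.
           (xs, ys) \<in> E \<longleftrightarrow> sat M (\<lambda>(_, i). (xs @ ys) ! i) \<phi>))"

definition eq_lang :: "('f, 'r, unit) lang \<Rightarrow> ('f, 'r, unit, 'e) struct
    \<Rightarrow> (('f, 'e) eqfun, 'r, 'e eqsort) lang" where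
  "eq_lang L M = \<lparr>
     sorts = insert Home {Quot n E | n E. def_equiv L M n E},
     funs = Old ` funs L \<union> {Proj n E | n E. def_equiv L M n E},
     fdom = (\<lambda>h. case h of Old f \<Rightarrow> map (\<lambda>_. Home) (fdom L f) | Proj n E \<Rightarrow> replicate n Home),
     fcod = (\<lambda>h. case h of Old f \<Rightarrow> Home | Proj n E \<Rightarrow> Quot n E),
     rels = rels L,
     rdom = (\<lambda>r. map (\<lambda>_. Home) (rdom L r)) \<rparr>"

definition eq_struct :: "('f, 'r, unit) lang \<Rightarrow> ('f, 'r, unit, 'e) struct
    \<Rightarrow> (('f, 'e) eqfun, 'r, 'e eqsort, 'e eqpoint) struct" where
  "eq_struct L M = \<lparr>
     univ = (\<lambda>s. case s of
         Home \<Rightarrow> Real ` points M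
       | Quot n E \<Rightarrow> {Class n E (E `` {xs}) | xs. def_equiv L M n E \<and> xs \<in> tuples M n}),
     fint = (\<lambda>h us. case h of
         Old f \<Rightarrow> Real (fint M f (map the_real us))
       | Proj n E \<Rightarrow> Class n E (E `` {map the_real us})),
     rint = (\<lambda>r us. rint M r (map the_real us)) \<rparr>"

text \<open>
  For \<open>M\<close> an elementary substructure of \<open>N\<close>: the imaginaries of \<open>M\<close>, as points of the imaginary
  expansion of \<open>N\<close>, namely the classes that have a representative in \<open>M\<close>.
\<close>

definition eq_points :: "('f, 'r, unit) lang \<Rightarrow> ('f, 'r, unit, 'e) struct
    \<Rightarrow> ('f, 'r, unit, 'e) struct \<Rightarrow> 'e eqpoint set" where
  "eq_points L N M =
     Real ` points M \<union> {Class n E (E `` {xs}) | n E xs. def_equiv L N n E \<and> xs \<in> tuples M n}"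

definition extends_ind :: "('f, 'r, unit, 'e) struct \<Rightarrow> 'k rel
    \<Rightarrow> ('e eqpoint set \<Rightarrow> 'e eqpoint set \<Rightarrow> 'e eqpoint set \<Rightarrow> bool)
    \<Rightarrow> ('e set \<Rightarrow> 'e set \<Rightarrow> 'e set \<Rightarrow> bool) \<Rightarrow> bool" where
  "extends_ind M kbar ind_eq ind \<longleftrightarrow>
     (\<forall>A B C. small_subset kbar M A \<and> small_subset kbar M B \<and> small_subset kbar M C \<longrightarrow>
        (ind_eq (Real ` A) (Real ` C) (Real ` B) \<longleftrightarrow> ind A C B))"

section \<open>Pairs\<close>

text \<open>The relation symbol \<open>None\<close> is the new unary predicate \<open>P\<close>.\<close>

definition lang2 :: "('f, 'r, unit) lang \<Rightarrow> ('f, 'r option, unit) lang" where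
  "lang2 L = \<lparr> sorts = sorts L, funs = funs L, fdom = fdom L, fcod = fcod L,
     rels = insert None (Some ` rels L),
     rdom = (\<lambda>r. case r of None \<Rightarrow> [()] | Some r' \<Rightarrow> rdom L r') \<rparr>"

definition reduct :: "('f, 'r option, unit, 'e) struct \<Rightarrow> ('f, 'r, unit, 'e) struct" where
  "reduct MP = \<lparr> univ = univ MP, fint = fint MP, rint = (\<lambda>r. rint MP (Some r)) \<rparr>"

definition Ppart :: "('f, 'r option, unit, 'e) struct \<Rightarrow> 'e set" where
  "Ppart MP = {x \<in> points MP. rint MP None [x]}"

text \<open>
  The theory of all expansions of models of \<open>T\<close> with universe in \<open>'e\<close>. When \<open>'e\<close> is the type of a
  \<open>kbar\<close>-saturated model of \<open>T\<close> with \<open>|T| <o kbar\<close>, restricting to this type loses nothing, by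
  Loewenheim-Skolem (or because all models of \<open>T\<close> are finite and isomorphic).
\<close>

definition theory2 :: "'e itself \<Rightarrow> ('f, 'r, unit) lang \<Rightarrow> ('f, 'r, unit) fm set
    \<Rightarrow> ('f, 'r option, unit) fm set" where
  "theory2 _ L T = {\<phi> \<in> sentences (lang2 L).
     \<forall>(NP :: ('f, 'r option, unit, 'e) struct) \<rho>.
       is_struct (lang2 L) NP \<and> models (reduct NP) T \<longrightarrow> sat NP \<rho> \<phi>}"

text \<open>\<open>MP\<close> is a model of \<open>T\<^sup>2\<close> whose underlying model of \<open>T\<close> is an elementary substructure of \<open>C\<close>.\<close>

definition pair_model :: "('f, 'r, unit) lang \<Rightarrow> ('f, 'r, unit) fm set
    \<Rightarrow> ('f, 'r, unit, 'e) struct \<Rightarrow> ('f, 'r option, unit, 'e) struct \<Rightarrow> bool" where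
  "pair_model L T C MP \<longleftrightarrow>
     is_struct (lang2 L) MP \<and> models MP (theory2 TYPE('e) L T) \<and>
     elementary_substructure L (reduct MP) C"

definition extension_property :: "('f, 'r, unit) lang \<Rightarrow> ('f, 'r, unit, 'e) struct \<Rightarrow> 'k rel
    \<Rightarrow> ('e set \<Rightarrow> 'e set \<Rightarrow> 'e set \<Rightarrow> bool) \<Rightarrow> ('f, 'r option, unit, 'e) struct \<Rightarrow> bool" where
  "extension_property L C k ind MP \<longleftrightarrow>
     (\<forall>A\<subseteq>points MP. |A| <o k \<longrightarrow>
        (\<forall>q\<in>S1 L C () A. \<exists>b\<in>points MP. realizes C b q \<and> ind {b} A (Ppart MP)))"

end

theory Submission
  imports Defs
begin

text \<open>
  Choose very small sets \<open>b\<close> and \<open>d\<close> of elements of the pair that contain representatives of the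
  imaginaries in \<open>c\<close> and \<open>a\<close>. The extension axiom on the imaginary side gives a copy \<open>\<sigma> b\<close> of \<open>b\<close>
  over \<open>a\<close> that is independent from \<open>d\<close> over \<open>a\<close>. By the extension property for tuples of the home
  sort, the type of \<open>\<sigma> b\<close> over \<open>d\<close> is realized in the pair by some \<open>b' = \<tau> (\<sigma> b)\<close> that is independent
  from \<open>P\<close> over \<open>d\<close>. Since \<open>\<tau>\<close> fixes \<open>d\<close>, hence \<open>a\<close>, also \<open>b'\<close> is independent from \<open>d\<close> over \<open>a\<close>;
  by transitivity \<open>b'\<close> is independent from \<open>P\<close> over \<open>a\<close> (\<open>ind_replace_base\<close>). The tuple \<open>c'\<close> is the
  image of \<open>c\<close> under the action of \<open>\<tau> \<circ> \<sigma>\<close> on imaginaries. It has the type of \<open>c\<close> over \<open>a\<close> because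
  \<open>\<tau> \<circ> \<sigma>\<close> fixes \<open>a\<close>, and it inherits independence from \<open>b'\<close>, from which it is definable
  (\<open>ind_rigid_left\<close>).

  The extension property for tuples (\<open>extension_property_tuples\<close>) follows from the one for single
  elements by transitivity and finite character. Passing between types and automorphisms uses strong
  homogeneity of the home sort only: an equality of types in the imaginary expansion yields a
  partial elementary map of the home sort (\<open>tp_eq_partial_elementary\<close>), hence an automorphism, and
  this acts on the imaginaries (\<open>eq_map_automorphism\<close>).
\<close>

section \<open>Satisfaction, automorphisms and types\<close>

lemma eval_trm_cong: "(\<And>x. x \<in> fv_trm t \<Longrightarrow> \<rho> x = \<rho>' x) \<Longrightarrow> eval_trm M \<rho> t = eval_trm M \<rho>' t"
proof (induction t)
  case (Fn f ts)
  then have "map (eval_trm M \<rho>) ts = map (eval_trm M \<rho>') ts" by auto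
  then show ?case by (simp del: map_eq_conv)
qed simp

lemma sat_cong: "(\<And>x. x \<in> fv \<phi> \<Longrightarrow> \<rho> x = \<rho>' x) \<Longrightarrow> sat M \<rho> \<phi> \<longleftrightarrow> sat M \<rho>' \<phi>"
proof (induction \<phi> arbitrary: \<rho> \<rho>')
  case (Eq t u)
  then show ?case using eval_trm_cong[of t \<rho> \<rho>' M] eval_trm_cong[of u \<rho> \<rho>' M] by simp
next
  case (Rel r ts)
  then have "map (eval_trm M \<rho>) ts = map (eval_trm M \<rho>') ts"
    by (auto intro!: eval_trm_cong)
  then show ?case by (simp del: map_eq_conv)
next
  case (Neg \<phi>)
  have "sat M \<rho> \<phi> \<longleftrightarrow> sat M \<rho>' \<phi>" by (rule Neg.IH) (use Neg.prems in auto)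
  then show ?case by simp
next
  case (Conj \<phi> \<psi>)
  have "sat M \<rho> \<phi> \<longleftrightarrow> sat M \<rho>' \<phi>" by (rule Conj.IH(1)) (use Conj.prems in auto)
  moreover have "sat M \<rho> \<psi> \<longleftrightarrow> sat M \<rho>' \<psi>" by (rule Conj.IH(2)) (use Conj.prems in auto)
  ultimately show ?case by simp
next
  case (Ex s n \<phi>)
  have "sat M (\<rho>((s, n) := e)) \<phi> \<longleftrightarrow> sat M (\<rho>'((s, n) := e)) \<phi>" for e
    by (rule Ex.IH) (use Ex.prems in auto)
  then show ?case by simp
qed

lemma finite_fv: "finite (fv (\<phi> :: ('f, 'r, 's) fm))"
proof -
  have trm: "finite (fv_trm t)" for t :: "('f, 's) trm"
    by (induction t) simp_all
  show ?thesis by (induction \<phi>) (auto simp: trm)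
qed

lemma univ_subset_points: "univ M s \<subseteq> points M"
  by (auto simp: points_def)

lemma automorphism_eval:
  assumes M: "is_struct L M" and \<sigma>: "automorphism L M \<sigma>"
  shows "wf_trm L t \<Longrightarrow> (\<And>s n. (s, n) \<in> fv_trm t \<Longrightarrow> \<rho> (s, n) \<in> univ M s) \<Longrightarrow>
    eval_trm M \<rho> t \<in> univ M (sort_of L t) \<and> eval_trm M (\<sigma> \<circ> \<rho>) t = \<sigma> (eval_trm M \<rho> t)"
proof (induction t)
  case (Fn f ts)
  have IH: "eval_trm M \<rho> t \<in> univ M (sort_of L t) \<and> eval_trm M (\<sigma> \<circ> \<rho>) t = \<sigma> (eval_trm M \<rho> t)"
    if "t \<in> set ts" for t
    by (rule Fn.IH[OF that]) (use Fn.prems that in auto)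
  have f: "f \<in> funs L" and dom: "map (sort_of L) ts = fdom L f" using Fn.prems by auto
  have xs: "list_all2 (\<lambda>x s. x \<in> univ M s) (map (eval_trm M \<rho>) ts) (fdom L f)"
    unfolding dom[symmetric] using IH by (auto simp: list_all2_conv_all_nth)
  have "map (eval_trm M (\<sigma> \<circ> \<rho>)) ts = map \<sigma> (map (eval_trm M \<rho>) ts)"
    using IH by auto
  moreover have "fint M f (map (eval_trm M \<rho>) ts) \<in> univ M (fcod L f)"
    using M f xs unfolding is_struct_def by blast
  moreover have "\<sigma> (fint M f (map (eval_trm M \<rho>) ts)) = fint M f (map \<sigma> (map (eval_trm M \<rho>) ts))"
    using \<sigma> f xs unfolding automorphism_def by blast
  ultimately show ?case by (simp del: map_map o_apply)
qed simp

lemma automorphism_sat: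
  assumes M: "is_struct L M" and \<sigma>: "automorphism L M \<sigma>"
  shows "wf_fm L \<phi> \<Longrightarrow> (\<And>s n. (s, n) \<in> fv \<phi> \<Longrightarrow> \<rho> (s, n) \<in> univ M s) \<Longrightarrow>
    sat M (\<sigma> \<circ> \<rho>) \<phi> \<longleftrightarrow> sat M \<rho> \<phi>"
proof (induction \<phi> arbitrary: \<rho>)
  case (Eq t u)
  have "inj_on \<sigma> (univ M (sort_of L t))"
    using \<sigma> by (auto simp: automorphism_def bij_betw_def)
  moreover have "eval_trm M \<rho> t \<in> univ M (sort_of L t) \<and>
      eval_trm M (\<sigma> \<circ> \<rho>) t = \<sigma> (eval_trm M \<rho> t)"
    by (rule automorphism_eval[OF M \<sigma>]) (use Eq in auto)
  moreover have "eval_trm M \<rho> u \<in> univ M (sort_of L t) \<and>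
      eval_trm M (\<sigma> \<circ> \<rho>) u = \<sigma> (eval_trm M \<rho> u)"
    using automorphism_eval[OF M \<sigma>, of u \<rho>] Eq by auto
  ultimately show ?case by (simp del: o_apply add: inj_on_eq_iff)
next
  case (Rel r ts)
  have IH: "eval_trm M \<rho> t \<in> univ M (sort_of L t) \<and> eval_trm M (\<sigma> \<circ> \<rho>) t = \<sigma> (eval_trm M \<rho> t)"
    if "t \<in> set ts" for t
    using automorphism_eval[OF M \<sigma>, of t \<rho>] Rel that by auto
  have r: "r \<in> rels L" and dom: "map (sort_of L) ts = rdom L r" using Rel.prems by auto
  have xs: "list_all2 (\<lambda>x s. x \<in> univ M s) (map (eval_trm M \<rho>) ts) (rdom L r)"
    unfolding dom[symmetric] using IH by (auto simp: list_all2_conv_all_nth)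
  have "map (eval_trm M (\<sigma> \<circ> \<rho>)) ts = map \<sigma> (map (eval_trm M \<rho>) ts)"
    using IH by auto
  moreover have "rint M r (map \<sigma> (map (eval_trm M \<rho>) ts)) = rint M r (map (eval_trm M \<rho>) ts)"
    using \<sigma> r xs unfolding automorphism_def by blast
  ultimately show ?case by (simp del: map_map o_apply)
next
  case (Ex s n \<phi>)
  have upd: "(\<sigma> \<circ> \<rho>)((s, n) := \<sigma> e) = \<sigma> \<circ> \<rho>((s, n) := e)" for e by auto
  have "sat M ((\<sigma> \<circ> \<rho>)((s, n) := \<sigma> e)) \<phi> \<longleftrightarrow> sat M (\<rho>((s, n) := e)) \<phi>" if "e \<in> univ M s" for e
    unfolding upd by (rule Ex.IH) (use Ex.prems that in auto)
  moreover have "\<sigma> ` univ M s = univ M s"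
    using \<sigma> by (auto simp: automorphism_def bij_betw_def)
  ultimately have "(\<exists>e\<in>univ M s. sat M ((\<sigma> \<circ> \<rho>)((s, n) := e)) \<phi>) \<longleftrightarrow>
      (\<exists>e\<in>univ M s. sat M (\<rho>((s, n) := e)) \<phi>)"
    by (metis (no_types, lifting) image_iff)
  then show ?case by (simp del: o_apply)
qed auto

lemma automorphism_comp:
  assumes "automorphism L M \<sigma>" "automorphism L M \<tau>"
  shows "automorphism L M (\<tau> \<circ> \<sigma>)"
proof -
  have in_dom: "list_all2 (\<lambda>x s. x \<in> univ M s) (map \<sigma> xs) ss"
    if "list_all2 (\<lambda>x s. x \<in> univ M s) xs ss" for xs ss
  proof -
    have "\<sigma> x \<in> univ M s" if "x \<in> univ M s" for x s
      using assms(1) that unfolding automorphism_def bij_betw_def by blast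
    then show ?thesis using that by (auto simp: list_all2_conv_all_nth)
  qed
  have "bij_betw (\<tau> \<circ> \<sigma>) (univ M s) (univ M s)" for s
    using assms by (auto simp: automorphism_def intro: bij_betw_trans)
  moreover have "\<forall>f\<in>funs L. \<forall>xs. list_all2 (\<lambda>x s. x \<in> univ M s) xs (fdom L f) \<longrightarrow>
     (\<tau> \<circ> \<sigma>) (fint M f xs) = fint M f (map (\<tau> \<circ> \<sigma>) xs)"
    using assms in_dom unfolding automorphism_def by (auto simp flip: map_map)
  moreover have "\<forall>r\<in>rels L. \<forall>xs. list_all2 (\<lambda>x s. x \<in> univ M s) xs (rdom L r) \<longrightarrow>
     rint M r (map (\<tau> \<circ> \<sigma>) xs) = rint M r xs"
    using assms in_dom unfolding automorphism_def by (auto simp flip: map_map)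
  ultimately show ?thesis unfolding automorphism_def by blast
qed

lemma tp_automorphism:
  assumes M: "is_struct L M" and \<sigma>: "automorphism L M \<sigma>"
    and fix_B: "\<And>x. x \<in> B \<Longrightarrow> \<sigma> x = x" and a: "a ` I \<subseteq> points M"
  shows "tp L M B I (\<sigma> \<circ> a) = tp L M B I a"
proof -
  have bij: "bij_betw \<sigma> (univ M s) (univ M s)" for s using \<sigma> by (simp add: automorphism_def)
  have srt: "\<sigma> x \<in> univ M s \<longleftrightarrow> x \<in> univ M s" if x: "x \<in> points M" for x s
  proof -
    obtain s' where s': "x \<in> univ M s'" using x by (auto simp: points_def)
    then have "\<sigma> x \<in> univ M s'" using bij bij_betwE by blast
    moreover have "s = s'" if "y \<in> univ M s" "y \<in> univ M s'" for y
      using M that unfolding is_struct_def by blast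
    ultimately show ?thesis using s' bij_betwE[OF bij] by blast
  qed
  have "{i \<in> I. (\<sigma> \<circ> a) i \<in> univ M s} = {i \<in> I. a i \<in> univ M s}" for s
    using a srt by auto
  moreover have "sat_over M (\<sigma> \<circ> a) p \<longleftrightarrow> sat_over M a p"
    if p: "p \<in> fms_over L M (\<lambda>s. {i \<in> I. a i \<in> univ M s}) B" for p
  proof -
    obtain \<phi> v where pv: "p = (\<phi>, v)" by (cases p)
    have wf: "wf_fm L \<phi>"
      and v: "\<And>s n. (s, n) \<in> fv \<phi> \<Longrightarrow> v (s, n) \<in> {i \<in> I. a i \<in> univ M s} <+> (B \<inter> univ M s)"
      using p unfolding pv fms_over_def by auto
    have "sat M (\<sigma> \<circ> (case_sum a id \<circ> v)) \<phi> \<longleftrightarrow> sat M (case_sum a id \<circ> v) \<phi>"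
      by (rule automorphism_sat[OF M \<sigma> wf]) (use v in fastforce)
    moreover have "sat M (case_sum (\<sigma> \<circ> a) id \<circ> v) \<phi> \<longleftrightarrow> sat M (\<sigma> \<circ> (case_sum a id \<circ> v)) \<phi>"
      by (rule sat_cong) (use v fix_B in fastforce)
    ultimately show ?thesis by (simp add: pv sat_over_def)
  qed
  ultimately show ?thesis unfolding tp_def by auto
qed

section \<open>Calculus of independence\<close>

locale independence =
  fixes L :: "('f, 'r, 's) lang" and M :: "('f, 'r, 's, 'e) struct" and kbar :: "'k rel"
    and ind :: "'e set \<Rightarrow> 'e set \<Rightarrow> 'e set \<Rightarrow> bool"
  assumes ind_rel: "independence_relation L M kbar ind"
    and kbar: "Cinfinite kbar"
begin

abbreviation small :: "'e set \<Rightarrow> bool" where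
  "small \<equiv> small_subset kbar M"

lemma small_Un [simp]: "small (A \<union> B) \<longleftrightarrow> small A \<and> small B"
proof
  assume "small (A \<union> B)"
  then show "small A \<and> small B"
    unfolding small_subset_def
    by (meson Un_subset_iff Un_upper1 Un_upper2 card_of_mono1 ordLeq_ordLess_trans)
next
  assume "small A \<and> small B"
  then show "small (A \<union> B)"
    unfolding small_subset_def using kbar card_of_Un_ordLess_infinite_Field[of kbar A B]
    by (auto simp: cinfinite_def)
qed

lemma small_mono: "small A \<Longrightarrow> B \<subseteq> A \<Longrightarrow> small B"
  unfolding small_subset_def by (meson card_of_mono1 ordLeq_ordLess_trans subset_trans)

lemmas ind_axioms = ind_rel[unfolded independence_relation_def Let_def]

lemma invariance:
  "small A \<Longrightarrow> small B \<Longrightarrow> small C \<Longrightarrow> automorphism L M \<sigma> \<Longrightarrow> ind A B C \<Longrightarrow>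
    ind (\<sigma> ` A) (\<sigma> ` B) (\<sigma> ` C)"
  using ind_axioms[THEN conjunct1] by blast

lemma normality: "small A \<Longrightarrow> small B \<Longrightarrow> small C \<Longrightarrow> ind A C B \<Longrightarrow> ind (A \<union> C) C B"
  using ind_axioms[THEN conjunct2, THEN conjunct1] by blast

lemma symmetry: "small A \<Longrightarrow> small B \<Longrightarrow> small C \<Longrightarrow> ind A B C \<Longrightarrow> ind C B A"
  using ind_axioms[THEN conjunct2, THEN conjunct2, THEN conjunct1] by simp

lemma transitivity:
  assumes "small A" "small B" "small C" "small D" "B \<subseteq> C" "C \<subseteq> D"
  shows "ind A B D \<longleftrightarrow> ind A B C \<and> ind A C D"
  using ind_axioms[THEN conjunct2, THEN conjunct2, THEN conjunct2, THEN conjunct1, rule_format, of A B C D]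
    assms by simp

lemma finite_character:
  assumes "small A" "small B" "small C"
  shows "ind A B C \<longleftrightarrow> (\<forall>A0\<subseteq>A. finite A0 \<longrightarrow> ind A0 B C)"
  using ind_axioms[THEN conjunct2, THEN conjunct2, THEN conjunct2, THEN conjunct2, THEN conjunct1,
      rule_format, of A B C] assms by simp

lemma extension:
  assumes "small A" "small B" "small C"
  obtains g where "g ` A \<subseteq> points M" "tp L M B A g = tp L M B A id" "ind (g ` A) B C"
  using ind_axioms[THEN conjunct2, THEN conjunct2, THEN conjunct2, THEN conjunct2, THEN conjunct2,
      THEN conjunct1, rule_format, of A B C] assms by blast

lemma mono_left:
  assumes "ind A B C" "A0 \<subseteq> A" "small A" "small B" "small C"
  shows "ind A0 B C"
proof -
  have "small A0" using assms small_mono by blast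
  then show ?thesis
    using finite_character[of A B C] finite_character[of A0 B C] assms by auto
qed

lemma mono_right:
  assumes "ind A B C" "C0 \<subseteq> C" "small A" "small B" "small C"
  shows "ind A B C0"
proof -
  have "small C0" using assms small_mono by blast
  then show ?thesis
    using symmetry[of A B C] mono_left[of C B A C0] symmetry[of C0 B A] assms by simp
qed

lemma normality_right:
  assumes "ind A B C" "small A" "small B" "small C"
  shows "ind A B (B \<union> C)"
  using assms normality[of C A B] symmetry[of A B C] symmetry[of "C \<union> B" B A]
  by (simp add: Un_commute)

lemma ind_base:
  assumes "small B" "small C"
  shows "ind B B C"
proof -
  have e: "small {}" using assms small_mono by blast
  have "ind {} B C" by (rule extension[OF e assms]) simp
  then show ?thesis using normality[OF e assms(2,1)] by simp
qed

text \<open>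
  A set \<open>X\<close> with only one realization of its type over \<open>B\<close> (as for \<open>X\<close> in the definable closure
  of \<open>B\<close>) is independent over \<open>B\<close> from everything, because the copy provided by extension is
  \<open>X\<close> itself.
\<close>

definition rigid :: "'e set \<Rightarrow> 'e set \<Rightarrow> bool" where
  "rigid B X \<longleftrightarrow> (\<forall>g. tp L M B X g = tp L M B X id \<longrightarrow> (\<forall>x\<in>X. g x = x))"

lemma ind_rigid:
  assumes "rigid B X" "small X" "small B" "small C"
  shows "ind X B C"
proof -
  obtain g where g: "tp L M B X g = tp L M B X id" "ind (g ` X) B C"
    using extension assms by metis
  then have "g ` X = X" using assms(1) by (auto simp: rigid_def image_def)
  with g show ?thesis by simp
qed

text \<open>Everything definable from the base and the right-hand side may be added to the right.\<close>

lemma ind_add_rigid: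
  assumes "ind A B C" "rigid (B \<union> C) X" "small A" "small B" "small C" "small X"
  shows "ind A B (X \<union> B \<union> C)"
proof -
  have "ind (X \<union> (B \<union> C)) (B \<union> C) A"
    using ind_rigid[OF assms(2), of A] normality[of X A "B \<union> C"] assms by simp
  then have "ind A (B \<union> C) (X \<union> B \<union> C)"
    using symmetry[of "X \<union> (B \<union> C)" "B \<union> C" A] assms by (simp add: Un_assoc)
  moreover have "ind A B (B \<union> C)" using normality_right assms by simp
  ultimately show ?thesis
    using transitivity[of A B "B \<union> C" "X \<union> B \<union> C"] assms by auto
qed

text \<open>Transitivity on the left-hand side.\<close>

lemma ind_chain_left:
  assumes "ind A B C" "ind D A C" "B \<subseteq> A" "small A" "small C" "small D"
  shows "ind (A \<union> D) B C"
proof -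
  have B: "small B" using assms small_mono by blast
  have "ind C B A" using symmetry assms B by blast
  moreover have "ind C A (A \<union> D)" using symmetry[of D A C] normality_right[of C A D] assms by simp
  ultimately have "ind C B (A \<union> D)" using transitivity[of C B A "A \<union> D"] assms B by auto
  then show ?thesis using symmetry[of C B "A \<union> D"] assms B by simp
qed

text \<open>
  Transitivity for a base \<open>B\<close> that is definable from the larger base \<open>D\<close> (and \<open>C\<close>) without being
  contained in it, as for imaginaries and their representatives.
\<close>

lemma ind_replace_base:
  assumes "ind A B D" "ind A D C" "rigid (D \<union> C) B" "small A" "small B" "small C" "small D"
  shows "ind A B C"
proof -
  have "ind A D (B \<union> D \<union> C)" using ind_add_rigid assms by blast
  then have "ind A (B \<union> D) (B \<union> D \<union> C)"
    using transitivity[of A D "B \<union> D" "B \<union> D \<union> C"] assms by auto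
  moreover have "ind A B (B \<union> D)" using normality_right assms by blast
  ultimately have "ind A B (B \<union> D \<union> C)"
    using transitivity[of A B "B \<union> D" "B \<union> D \<union> C"] assms by auto
  then show ?thesis using mono_right[of A B "B \<union> D \<union> C" C] assms by auto
qed

lemma ind_rigid_left:
  assumes "ind A B C" "rigid (B \<union> A) X" "small A" "small B" "small C" "small X"
  shows "ind X B C"
proof -
  have "ind C B (X \<union> B \<union> A)" using ind_add_rigid[of C B A X] symmetry assms by blast
  then have "ind (X \<union> B \<union> A) B C" using symmetry[of C B "X \<union> B \<union> A"] assms by simp
  then show ?thesis using mono_left[of "X \<union> B \<union> A" B C X] assms by auto
qed

end

section \<open>Partial elementary relations\<close>

text \<open>
  A partial elementary map of a one-sorted structure, presented as its graph, so that extending maps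
  means including graphs. The condition allows the same variable assignments on both sides; being
  the graph of an injective function is a consequence.
\<close>

definition partial_elementary ::
  "('f, 'r, unit) lang \<Rightarrow> ('f, 'r, unit, 'e) struct \<Rightarrow> ('e \<times> 'e) set \<Rightarrow> bool" where
  "partial_elementary L M G \<longleftrightarrow> G \<subseteq> points M \<times> points M \<and>
     (\<forall>\<phi> \<rho> \<rho>'. wf_fm L \<phi> \<and> (\<forall>x\<in>fv \<phi>. (\<rho> x, \<rho>' x) \<in> G) \<longrightarrow> (sat M \<rho> \<phi> \<longleftrightarrow> sat M \<rho>' \<phi>))"

lemma partial_elementary_sat:
  assumes "partial_elementary L M G" "wf_fm L \<phi>" "\<And>x. x \<in> fv \<phi> \<Longrightarrow> (\<rho> x, \<rho>' x) \<in> G"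
  shows "sat M \<rho> \<phi> \<longleftrightarrow> sat M \<rho>' \<phi>"
  using assms unfolding partial_elementary_def by blast

lemma partial_elementary_inj:
  assumes "sorts L = {()}" "partial_elementary L M G" "(x, y) \<in> G" "(x', y') \<in> G"
  shows "x = x' \<longleftrightarrow> y = y'"
proof -
  define \<phi> :: "('a, 'b, unit) fm" where "\<phi> = Eq (Var () 0) (Var () 1)"
  have "sat M (\<lambda>(_, n). if n = 0 then x else x') \<phi> \<longleftrightarrow>
      sat M (\<lambda>(_, n). if n = 0 then y else y') \<phi>"
    by (rule partial_elementary_sat[OF assms(2)]) (use assms in \<open>auto simp: \<phi>_def\<close>)
  then show ?thesis by (simp add: \<phi>_def)
qed

lemma partial_elementary_Id_on: "A \<subseteq> points M \<Longrightarrow> partial_elementary L M (Id_on A)"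
proof -
  have "sat M \<rho> \<phi> \<longleftrightarrow> sat M \<rho>' \<phi>" if "\<forall>x\<in>fv \<phi>. (\<rho> x, \<rho>' x) \<in> Id_on A" for \<phi> \<rho> \<rho>'
    by (rule sat_cong) (use that in auto)
  moreover assume "A \<subseteq> points M"
  ultimately show ?thesis unfolding partial_elementary_def by blast
qed

lemma partial_elementary_chain:
  assumes ne: "\<C> \<noteq> {}" and chain: "subset.chain \<A> \<C>"
    and pe: "\<And>G. G \<in> \<C> \<Longrightarrow> partial_elementary L M G"
  shows "partial_elementary L M (\<Union>\<C>)"
  unfolding partial_elementary_def
proof (intro conjI allI impI)
  show "\<Union>\<C> \<subseteq> points M \<times> points M" using pe unfolding partial_elementary_def by blast
next
  fix \<phi> \<rho> \<rho>' assume *: "wf_fm L \<phi> \<and> (\<forall>x\<in>fv \<phi>. (\<rho> x, \<rho>' x) \<in> \<Union>\<C>)"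
  have "finite ((\<lambda>x. (\<rho> x, \<rho>' x)) ` fv \<phi>)" by (simp add: finite_fv)
  moreover have "(\<lambda>x. (\<rho> x, \<rho>' x)) ` fv \<phi> \<subseteq> \<Union>\<C>" using * by blast
  ultimately obtain G where G: "G \<in> \<C>" "(\<lambda>x. (\<rho> x, \<rho>' x)) ` fv \<phi> \<subseteq> G"
    using finite_subset_Union_chain[OF _ _ ne chain] by blast
  show "sat M \<rho> \<phi> \<longleftrightarrow> sat M \<rho>' \<phi>"
    by (rule partial_elementary_sat[OF pe[OF G(1)]]) (use * G in auto)
qed

lemma points_one_sorted: "points (M :: ('f, 'r, unit, 'e) struct) = univ M s"
proof -
  have "s = ()" by simp
  then show ?thesis by (auto simp: points_def UNIV_unit)
qed

text \<open>Strong homogeneity, restated for graphs.\<close>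

lemma partial_elementary_automorphism:
  fixes L :: "('f, 'r, unit) lang"
  assumes L: "sorts L = {()}" and C: "monster L C kbar"
    and G: "partial_elementary L C G" and small: "|Domain G| <o kbar"
  obtains \<sigma> where "automorphism L C \<sigma>" "\<And>x y. (x, y) \<in> G \<Longrightarrow> \<sigma> x = y"
proof -
  define g where "g x = (SOME y. (x, y) \<in> G)" for x
  have g: "(x, g x) \<in> G" if "x \<in> Domain G" for x
    using that unfolding g_def by (metis DomainE someI)
  have pts: "Domain G \<subseteq> points C" "g ` Domain G \<subseteq> points C"
    using G g unfolding partial_elementary_def by blast+
  have idx: "{i \<in> Domain G. id i \<in> univ C s} = Domain G"
    "{i \<in> Domain G. g i \<in> univ C s} = Domain G" for s
    using pts unfolding points_one_sorted[of C s] by auto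
  have "sat_over C id p \<longleftrightarrow> sat_over C g p" if "p \<in> fms_over L C (\<lambda>s. Domain G) {}" for p
  proof -
    obtain \<phi> v where pv: "p = (\<phi>, v)" by (cases p)
    have wf: "wf_fm L \<phi>" and v: "\<And>x. x \<in> fv \<phi> \<Longrightarrow> v x \<in> Inl ` Domain G"
      using that unfolding pv fms_over_def by (auto simp: Plus_def split: prod.splits)
    have "((case_sum id id \<circ> v) x, (case_sum g id \<circ> v) x) \<in> G" if x: "x \<in> fv \<phi>" for x
    proof -
      obtain u where u: "v x = Inl u" "u \<in> Domain G" using v[OF x] by blast
      show ?thesis using g[OF u(2)] by (simp add: u(1))
    qed
    then have "sat C (case_sum id id \<circ> v) \<phi> \<longleftrightarrow> sat C (case_sum g id \<circ> v) \<phi>"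
      by (rule partial_elementary_sat[OF G wf])
    then show ?thesis unfolding pv sat_over_def fst_conv snd_conv .
  qed
  then have "tp L C {} (Domain G) id = tp L C {} (Domain G) g"
    unfolding tp_def idx by auto
  then obtain \<sigma> where \<sigma>: "automorphism L C \<sigma>" "\<forall>x\<in>Domain G. \<sigma> x = g x"
    using C pts small unfolding monster_def strongly_homogeneous_def small_subset_def by blast
  have "\<sigma> x = y" if "(x, y) \<in> G" for x y
  proof -
    have "(x, g x) \<in> G" using that g by blast
    then have "g x = y" using partial_elementary_inj[OF L G that] by blast
    then show ?thesis using \<sigma> that by blast
  qed
  with \<sigma> that show thesis by blast
qed

section \<open>The extension property for tuples\<close>

text \<open>
  One step of the construction: extend \<open>G\<close> to an automorphism \<open>\<sigma>\<close> and realize in the pair the type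
  of \<open>\<sigma> x\<close> over the range of \<open>G\<close>.
\<close>

lemma extension_property_realize:
  assumes L: "sorts L = {()}" and C: "monster L C kbar"
    and ext: "extension_property L C k ind MP"
    and M: "points MP \<subseteq> points C"
    and G: "partial_elementary L C G" and dom: "|Domain G| <o kbar"
    and ran: "Range G \<subseteq> points MP" "|Range G| <o k" and x: "x \<in> points C"
  obtains y where "y \<in> points MP" "partial_elementary L C (insert (x, y) G)"
    "ind {y} (Range G) (Ppart MP)"
proof -
  obtain \<sigma> where \<sigma>: "automorphism L C \<sigma>" and \<sigma>G: "\<And>u w. (u, w) \<in> G \<Longrightarrow> \<sigma> u = w"
    using partial_elementary_automorphism[OF L C G dom] by blast
  have C_struct: "is_struct L C" using C by (simp add: monster_def)
  have \<sigma>x: "\<sigma> x \<in> univ C ()"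
    using \<sigma> x unfolding points_one_sorted[of C "()"] automorphism_def by (blast dest: bij_betwE)
  define F where "F = fms_over L C (\<lambda>s. if s = () then {()} else {}) (Range G)"
  define q where "q = {p \<in> F. sat_over C (\<lambda>_. \<sigma> x) p}"
  have "(\<phi>, v) \<in> q \<or> (Neg \<phi>, v) \<in> q" if "(\<phi>, v) \<in> F" for \<phi> v
    using that unfolding q_def F_def fms_over_def sat_over_def by auto
  then have "q \<in> S1 L C () (Range G)"
    using \<sigma>x unfolding S1_def Let_def F_def[symmetric] by (auto simp: q_def)
  then obtain y where y: "y \<in> points MP" "realizes C y q" "ind {y} (Range G) (Ppart MP)"
    using ext ran unfolding extension_property_def by blast
  have "partial_elementary L C (insert (x, y) G)"
    unfolding partial_elementary_def
  proof (intro conjI allI impI)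
    show "insert (x, y) G \<subseteq> points C \<times> points C"
      using G x y M unfolding partial_elementary_def by auto
  next
    fix \<phi> \<rho> \<rho>' assume *: "wf_fm L \<phi> \<and> (\<forall>z\<in>fv \<phi>. (\<rho> z, \<rho>' z) \<in> insert (x, y) G)"
    define v where "v z = (if (\<rho> z, \<rho>' z) = (x, y) then Inl () else Inr (\<rho>' z))" for z
    have v: "(\<phi>, v) \<in> F"
      using * G unfolding F_def fms_over_def v_def partial_elementary_def points_one_sorted[of C "()"]
      by auto
    have "sat C \<rho> \<phi> \<longleftrightarrow> sat C (\<sigma> \<circ> \<rho>) \<phi>"
      by (rule automorphism_sat[OF C_struct \<sigma>, symmetric])
        (use * G x in \<open>auto simp: partial_elementary_def points_one_sorted[of C "()"]\<close>)
    also have "\<dots> \<longleftrightarrow> sat C (case_sum (\<lambda>_. \<sigma> x) id \<circ> v) \<phi>"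
      by (rule sat_cong) (use * \<sigma>G in \<open>auto simp: v_def\<close>)
    also have "\<dots> \<longleftrightarrow> sat C (case_sum (\<lambda>_. y) id \<circ> v) \<phi>"
    proof -
      have "(\<phi>, v) \<in> q \<or> (Neg \<phi>, v) \<in> q"
        using v unfolding q_def F_def fms_over_def sat_over_def by auto
      then have "(\<phi>, v) \<in> q \<and> sat_over C (\<lambda>_. y) (\<phi>, v) \<or>
          (Neg \<phi>, v) \<in> q \<and> sat_over C (\<lambda>_. y) (Neg \<phi>, v)"
        using y(2) unfolding realizes_def by blast
      then show ?thesis unfolding q_def sat_over_def by auto
    qed
    also have "\<dots> \<longleftrightarrow> sat C \<rho>' \<phi>"
      by (rule sat_cong) (use * in \<open>auto simp: v_def\<close>)
    finally show "sat C \<rho> \<phi> \<longleftrightarrow> sat C \<rho>' \<phi>" .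
  qed
  with y that show thesis by blast
qed

text \<open>
  The extension property for one element passes to very small tuples. The set \<open>b\<close> need not lie in
  the pair: an automorphism over \<open>d\<close> moves it there. Instead of a transfinite
  enumeration of \<open>b\<close>, Zorn's lemma is applied to partial elementary graphs on \<open>d \<union> b\<close> that are the
  identity on \<open>d\<close> and whose range is independent from \<open>P\<close>; these are closed under unions of
  chains by finite character.
\<close>

lemma extension_property_tuples:
  fixes L :: "('f, 'r, unit) lang" and kbar k :: "'k rel"
  assumes L: "sorts L = {()}" and C: "monster L C kbar"
    and ind: "independence L C kbar ind"
    and k: "Cinfinite k" "k <o kbar"
    and ext: "extension_property L C k ind MP"
    and M: "points MP \<subseteq> points C" "|points MP| <o kbar"
    and d: "d \<subseteq> points MP" "|d| <o k" and b: "b \<subseteq> points C" "|b| <o k"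
  obtains \<tau> where "automorphism L C \<tau>" "\<And>x. x \<in> d \<Longrightarrow> \<tau> x = x" "\<tau> ` b \<subseteq> points MP"
    "ind (\<tau> ` b) d (Ppart MP)"
proof -
  interpret independence L C kbar ind by (rule ind)
  define A where "A = d \<union> b"
  have A: "|A| <o k"
    using k d b card_of_Un_ordLess_infinite_Field[of k d b] unfolding A_def cinfinite_def by auto
  have A_C: "A \<subseteq> points C" using d b M by (auto simp: A_def)
  have small_M: "small X" if "X \<subseteq> points MP" for X
    using small_mono[of "points MP" X] M that by (simp add: small_subset_def)
  have P: "Ppart MP \<subseteq> points MP" unfolding Ppart_def by blast
  \<comment> \<open>\<open>partial_elementary\<close> is closed under unions of chains, as formulas have finitely many variables\<close>
  define \<A> where "\<A> = {G. Id_on d \<subseteq> G \<and> G \<subseteq> A \<times> points MP \<and> partial_elementary L C G \<and>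
    ind (Range G) d (Ppart MP)}"
  have "\<exists>G\<in>\<A>. \<forall>X\<in>\<A>. G \<subseteq> X \<longrightarrow> X = G"
  proof (rule subset_Zorn_nonempty)
    have "partial_elementary L C (Id_on d)"
      by (rule partial_elementary_Id_on) (use d M in blast)
    moreover have "ind d d (Ppart MP)" by (intro ind_base small_M d P)
    ultimately have "Id_on d \<in> \<A>" using d by (auto simp: \<A>_def A_def)
    then show "\<A> \<noteq> {}" by blast
  next
    fix \<C> assume ne: "\<C> \<noteq> {}" and chain: "subset.chain \<A> \<C>"
    have \<C>: "\<C> \<subseteq> \<A>" using chain by (auto simp: subset.chain_def)
    have sub: "Range (\<Union>\<C>) \<subseteq> points MP" using \<C> by (auto simp: \<A>_def)
    have "ind R0 d (Ppart MP)" if R0: "R0 \<subseteq> Range (\<Union>\<C>)" "finite R0" for R0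
    proof -
      have "R0 \<subseteq> snd ` \<Union>\<C>" using R0 by (auto simp: Range_snd)
      then obtain F where F: "F \<subseteq> \<Union>\<C>" "finite F" "R0 = snd ` F"
        using finite_subset_image[OF R0(2)] by metis
      then obtain G where G: "G \<in> \<C>" "F \<subseteq> G"
        using finite_subset_Union_chain[OF F(2,1) ne chain] by blast
      then have R0G: "R0 \<subseteq> Range G" using F by (auto simp: Range_snd)
      have "G \<in> \<A>" using G \<C> by blast
      then have GA: "ind (Range G) d (Ppart MP)" "Range G \<subseteq> points MP" by (auto simp: \<A>_def)
      show ?thesis by (intro mono_left[OF GA(1) R0G] small_M GA(2) d P)
    qed
    then have "ind (Range (\<Union>\<C>)) d (Ppart MP)"
      using finite_character[OF small_M[OF sub] small_M[OF d(1)] small_M[OF P]] by blast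
    moreover have "partial_elementary L C (\<Union>\<C>)"
      by (rule partial_elementary_chain[OF ne chain]) (use \<C> in \<open>auto simp: \<A>_def\<close>)
    ultimately show "\<Union>\<C> \<in> \<A>" using \<C> ne unfolding \<A>_def by blast
  qed
  then obtain G where G: "G \<in> \<A>" and max: "\<And>X. X \<in> \<A> \<Longrightarrow> G \<subseteq> X \<Longrightarrow> X = G" by blast
  have pe: "partial_elementary L C G" and G_sub: "Id_on d \<subseteq> G" "G \<subseteq> A \<times> points MP"
    and G_ind: "ind (Range G) d (Ppart MP)" using G by (auto simp: \<A>_def)
  have dom_k: "|Domain G| <o k"
    using G_sub A card_of_mono1[of "Domain G" A] by (auto intro: ordLeq_ordLess_trans)
  then have dom: "|Domain G| <o kbar" using k ordLess_transitive by blast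
  obtain \<sigma> where \<sigma>: "automorphism L C \<sigma>" and \<sigma>G: "\<And>x y. (x, y) \<in> G \<Longrightarrow> \<sigma> x = y"
    using partial_elementary_automorphism[OF L C pe dom] by blast
  have "Range G = \<sigma> ` Domain G" using \<sigma>G by force
  then have ran: "|Range G| <o k"
    using card_of_image[of \<sigma> "Domain G"] dom_k by (auto intro: ordLeq_ordLess_trans)
  have ran_M: "Range G \<subseteq> points MP" using G_sub by auto
  have "x \<in> Domain G" if x: "x \<in> A" for x
  proof -
    have "x \<in> points C" using x A_C by blast
    then obtain y where y: "y \<in> points MP" "partial_elementary L C (insert (x, y) G)"
      "ind {y} (Range G) (Ppart MP)"
      by (rule extension_property_realize[OF L C ext M(1) pe dom ran_M ran])
    have "d \<subseteq> Range G" using G_sub by auto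
    then have "ind (Range G \<union> {y}) d (Ppart MP)"
      by (intro ind_chain_left[OF G_ind y(3)] small_M ran_M P) (use y(1) in auto)
    then have "insert (x, y) G \<in> \<A>" using y G_sub x by (auto simp: \<A>_def)
    then have "insert (x, y) G = G" by (rule max) auto
    then show ?thesis by blast
  qed
  then have AG: "(x, \<sigma> x) \<in> G" if "x \<in> A" for x using \<sigma>G that by blast
  have \<sigma>d: "\<sigma> x = x" if "x \<in> d" for x using that G_sub \<sigma>G by blast
  have \<sigma>b: "\<sigma> ` b \<subseteq> Range G" using AG by (auto simp: A_def)
  then have \<sigma>_ind: "ind (\<sigma> ` b) d (Ppart MP)"
    by (intro mono_left[OF G_ind] small_M ran_M d P)
  show thesis by (rule that[OF \<sigma> _ subset_trans[OF \<sigma>b ran_M] \<sigma>_ind]) (rule \<sigma>d)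
qed

section \<open>Automorphisms of the imaginary expansion\<close>

lemma eq_lang_simps [simp]:
  "sorts (eq_lang L C) = insert Home {Quot n E | n E. def_equiv L C n E}"
  "funs (eq_lang L C) = Old ` funs L \<union> {Proj n E | n E. def_equiv L C n E}"
  "fdom (eq_lang L C) (Old f) = map (\<lambda>_. Home) (fdom L f)"
  "fdom (eq_lang L C) (Proj n E) = replicate n Home"
  "fcod (eq_lang L C) (Old f) = Home"
  "fcod (eq_lang L C) (Proj n E) = Quot n E"
  "rels (eq_lang L C) = rels L"
  "rdom (eq_lang L C) r = map (\<lambda>_. Home) (rdom L r)"
  by (simp_all add: eq_lang_def)

lemma eq_struct_simps [simp]:
  "univ (eq_struct L C) Home = Real ` points C"
  "univ (eq_struct L C) (Quot n E) =
    {Class n E (E `` {xs}) | xs. def_equiv L C n E \<and> xs \<in> tuples C n}"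
  "fint (eq_struct L C) (Old f) us = Real (fint C f (map the_real us))"
  "fint (eq_struct L C) (Proj n E) us = Class n E (E `` {map the_real us})"
  "rint (eq_struct L C) r us = rint C r (map the_real us)"
  by (simp_all add: eq_struct_def)

lemma list_all2_Home:
  "list_all2 (\<lambda>x s. x \<in> univ (eq_struct L C) s) us (map (\<lambda>_. Home) ss) \<longleftrightarrow>
    length us = length ss \<and> (\<exists>xs. us = map Real xs \<and> set xs \<subseteq> points C)"
proof
  assume *: "list_all2 (\<lambda>x s. x \<in> univ (eq_struct L C) s) us (map (\<lambda>_. Home) ss)"
  then have len: "length us = length ss" by (auto dest: list_all2_lengthD)
  have "u \<in> Real ` points C" if "u \<in> set us" for u
    using * that by (auto simp: list_all2_conv_all_nth in_set_conv_nth)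
  then have "us \<in> lists (Real ` points C)" by blast
  then have "us \<in> map Real ` lists (points C)" by (simp only: lists_image)
  with len show "length us = length ss \<and> (\<exists>xs. us = map Real xs \<and> set xs \<subseteq> points C)" by blast
next
  assume "length us = length ss \<and> (\<exists>xs. us = map Real xs \<and> set xs \<subseteq> points C)"
  then show "list_all2 (\<lambda>x s. x \<in> univ (eq_struct L C) s) us (map (\<lambda>_. Home) ss)"
    by (clarsimp simp: list_all2_conv_all_nth) (metis imageI nth_mem subsetD)
qed

lemma list_all2_one_sorted:
  fixes M :: "('f, 'r, unit, 'e) struct"
  shows "list_all2 (\<lambda>x s. x \<in> univ M s) xs ss \<longleftrightarrow> length xs = length ss \<and> set xs \<subseteq> points M"
  unfolding points_one_sorted[of M "()"]
  by (fastforce simp: list_all2_conv_all_nth in_set_conv_nth subset_iff)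

lemma map_the_real_Real [simp]: "map (the_real \<circ> Real) xs = xs"
  by (simp add: comp_def)

lemma eq_struct_is_struct:
  fixes C :: "('f, 'r, unit, 'e) struct"
  assumes L: "sorts L = {()}" and C: "is_struct L C"
  shows "is_struct (eq_lang L C) (eq_struct L C)"
  unfolding is_struct_def
proof (intro conjI allI impI ballI)
  obtain x where x: "x \<in> points C"
    using L C unfolding is_struct_def points_one_sorted[of C "()"] by blast
  fix s
  have "replicate n x \<in> tuples C n" for n using x by (auto simp: tuples_def)
  then show "univ (eq_struct L C) s \<noteq> {} \<longleftrightarrow> s \<in> sorts (eq_lang L C)"
    using x by (cases s) auto
next
  fix s s' :: "'e eqsort" assume "s \<noteq> s'"
  then show "univ (eq_struct L C) s \<inter> univ (eq_struct L C) s' = {}"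
    by (cases s; cases s') auto
next
  fix h us
  assume h: "h \<in> funs (eq_lang L C)"
    and us: "list_all2 (\<lambda>x s. x \<in> univ (eq_struct L C) s) us (fdom (eq_lang L C) h)"
  show "fint (eq_struct L C) h us \<in> univ (eq_struct L C) (fcod (eq_lang L C) h)"
  proof (cases h)
    case (Old f)
    then obtain xs where xs: "us = map Real xs" "set xs \<subseteq> points C" "length xs = length (fdom L f)"
      using us by (auto simp: list_all2_Home)
    have "f \<in> funs L" using h Old by auto
    then have "fint C f xs \<in> points C"
      using C xs univ_subset_points[of C]
      unfolding is_struct_def list_all2_one_sorted by blast
    then show ?thesis by (simp add: Old xs)
  next
    case (Proj n E)
    have "replicate n Home = map (\<lambda>_. Home) (replicate n Home :: 'e eqsort list)" by simp
    then obtain xs where xs: "us = map Real xs" "set xs \<subseteq> points C" "length xs = n"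
      using us unfolding Proj eq_lang_simps by (metis length_map length_replicate list_all2_Home)
    then show ?thesis using h Proj by (auto simp: tuples_def)
  qed
qed

text \<open>Definable without parameters, \<open>E\<close> is invariant under automorphisms.\<close>

lemma def_equiv_automorphism:
  assumes L: "sorts L = {()}" and C: "is_struct L C" and \<sigma>: "automorphism L C \<sigma>"
    and E: "def_equiv L C n E" and xs: "xs \<in> tuples C n" and ys: "ys \<in> tuples C n"
  shows "(map \<sigma> xs, map \<sigma> ys) \<in> E \<longleftrightarrow> (xs, ys) \<in> E"
proof -
  obtain \<phi> where wf: "wf_fm L \<phi>" and fv: "fv \<phi> \<subseteq> {((), i) | i. i < 2 * n}"
    and \<phi>: "\<And>xs ys. xs \<in> tuples C n \<Longrightarrow> ys \<in> tuples C n \<Longrightarrow>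
      (xs, ys) \<in> E \<longleftrightarrow> sat C (\<lambda>(_, i). (xs @ ys) ! i) \<phi>"
    using E unfolding def_equiv_def by blast
  have \<sigma>_pts: "\<sigma> x \<in> points C" if "x \<in> points C" for x
    using \<sigma> that unfolding points_one_sorted[of C "()"] automorphism_def by (blast dest: bij_betwE)
  have len: "length xs = n" "length ys = n" using xs ys by (auto simp: tuples_def)
  have pts: "(xs @ ys) ! i \<in> points C" if "i < 2 * n" for i
    using nth_mem[of i "xs @ ys"] xs ys that by (auto simp: tuples_def)
  have "map \<sigma> xs \<in> tuples C n" "map \<sigma> ys \<in> tuples C n"
    using xs ys \<sigma>_pts by (auto simp: tuples_def)
  then have "(map \<sigma> xs, map \<sigma> ys) \<in> E \<longleftrightarrow> sat C (\<lambda>(_, i). (map \<sigma> xs @ map \<sigma> ys) ! i) \<phi>"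
    by (rule \<phi>)
  also have "\<dots> \<longleftrightarrow> sat C (\<sigma> \<circ> (\<lambda>(_, i). (xs @ ys) ! i)) \<phi>"
  proof (rule sat_cong)
    fix x assume "x \<in> fv \<phi>"
    then obtain i where i: "x = ((), i)" "i < 2 * n" using fv by blast
    then have "(map \<sigma> (xs @ ys)) ! i = \<sigma> ((xs @ ys) ! i)" by (intro nth_map) (simp add: len)
    then show "(\<lambda>(_, i). (map \<sigma> xs @ map \<sigma> ys) ! i) x = (\<sigma> \<circ> (\<lambda>(_, i). (xs @ ys) ! i)) x"
      by (simp add: i)
  qed
  also have "\<dots> \<longleftrightarrow> sat C (\<lambda>(_, i). (xs @ ys) ! i) \<phi>"
  proof (rule automorphism_sat[OF C \<sigma> wf])
    fix s i assume "(s, i) \<in> fv \<phi>"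
    then have "i < 2 * n" using fv by blast
    from pts[OF this] show "(\<lambda>(_, i). (xs @ ys) ! i) (s, i) \<in> univ C s"
      unfolding points_one_sorted[of C s] by simp
  qed
  also have "\<dots> \<longleftrightarrow> (xs, ys) \<in> E" using \<phi> xs ys by blast
  finally show ?thesis .
qed

text \<open>
  The action of an automorphism of the home sort on imaginaries: a class is mapped to the set of
  the images of its elements, with the same sort.
\<close>

definition eq_map :: "('e \<Rightarrow> 'e) \<Rightarrow> 'e eqpoint \<Rightarrow> 'e eqpoint" where
  "eq_map \<sigma> x = (case x of Real e \<Rightarrow> Real (\<sigma> e) | Class n E X \<Rightarrow> Class n E (map \<sigma> ` X))"

lemma eq_map_Real [simp]: "eq_map \<sigma> (Real x) = Real (\<sigma> x)"
  by (simp add: eq_map_def)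

lemma eq_map_image_Real: "eq_map \<sigma> ` Real ` X = Real ` \<sigma> ` X"
  by (simp add: image_image)

lemma automorphism_tuples:
  fixes C :: "('f, 'r, unit, 'e) struct"
  assumes \<sigma>: "automorphism L C \<sigma>"
  shows "map \<sigma> ` tuples C n = tuples C n"
proof -
  have surj: "\<sigma> ` points C = points C"
    using \<sigma> unfolding points_one_sorted[of C "()"] automorphism_def bij_betw_def by blast
  have "tuples C n = {xs \<in> lists (points C). length xs = n}" by (auto simp: tuples_def)
  also have "\<dots> = {xs \<in> lists (\<sigma> ` points C). length xs = n}" by (simp add: surj)
  also have "\<dots> = map \<sigma> ` {xs \<in> lists (points C). length xs = n}"
    unfolding lists_image by auto
  also have "\<dots> = map \<sigma> ` tuples C n" by (intro arg_cong[of _ _ "image _"]) (auto simp: tuples_def)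
  finally show ?thesis by simp
qed

lemma eq_map_Class:
  assumes L: "sorts L = {()}" and C: "is_struct L C" and \<sigma>: "automorphism L C \<sigma>"
    and E: "def_equiv L C n E" and xs: "xs \<in> tuples C n"
  shows "eq_map \<sigma> (Class n E (E `` {xs})) = Class n E (E `` {map \<sigma> xs})"
proof -
  have E_tup: "E \<subseteq> tuples C n \<times> tuples C n"
    using E by (auto simp: def_equiv_def equiv_def refl_on_def)
  have inv: "(map \<sigma> xs, map \<sigma> ys) \<in> E \<longleftrightarrow> (xs, ys) \<in> E" if "ys \<in> tuples C n" for ys
    using def_equiv_automorphism[OF L C \<sigma> E xs that] .
  have "E `` {map \<sigma> xs} \<subseteq> map \<sigma> ` (E `` {xs})"
  proof
    fix us assume us: "us \<in> E `` {map \<sigma> xs}"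
    then have "us \<in> map \<sigma> ` tuples C n" using E_tup unfolding automorphism_tuples[OF \<sigma>] by blast
    then obtain ys where "ys \<in> tuples C n" "us = map \<sigma> ys" by blast
    then show "us \<in> map \<sigma> ` (E `` {xs})" using us inv by simp
  qed
  moreover have "map \<sigma> ` (E `` {xs}) \<subseteq> E `` {map \<sigma> xs}"
    using inv E_tup by auto
  ultimately have "map \<sigma> ` (E `` {xs}) = E `` {map \<sigma> xs}" by blast
  then show ?thesis by (simp add: eq_map_def)
qed

lemma eq_map_automorphism:
  fixes C :: "('f, 'r, unit, 'e) struct"
  assumes L: "sorts L = {()}" and C: "is_struct L C" and \<sigma>: "automorphism L C \<sigma>"
  shows "automorphism (eq_lang L C) (eq_struct L C) (eq_map \<sigma>)"
  unfolding automorphism_def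
proof (intro conjI allI impI ballI)
  have \<sigma>_bij: "bij_betw \<sigma> (points C) (points C)"
    using \<sigma> unfolding points_one_sorted[of C "()"] automorphism_def by blast
  have cls: "eq_map \<sigma> (Class n E (E `` {xs})) = Class n E (E `` {map \<sigma> xs})"
    if "def_equiv L C n E" "xs \<in> tuples C n" for n E xs
    using eq_map_Class[OF L C \<sigma> that] .
  show "bij_betw (eq_map \<sigma>) (univ (eq_struct L C) s) (univ (eq_struct L C) s)" for s
  proof (cases s)
    case Home
    then show ?thesis using \<sigma>_bij by (auto simp: bij_betw_def inj_on_def image_image)
  next
    case (Quot n E)
    show ?thesis
    proof (cases "def_equiv L C n E")
      case E: True
      have eqv: "equiv (tuples C n) E" using E by (simp add: def_equiv_def)
      have univ: "univ (eq_struct L C) s = (\<lambda>xs. Class n E (E `` {xs})) ` tuples C n"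
        using E by (auto simp: Quot)
      have tup: "map \<sigma> xs \<in> tuples C n" if "xs \<in> tuples C n" for xs
        using automorphism_tuples[OF \<sigma>, of n] that by blast
      have "inj_on (eq_map \<sigma>) (univ (eq_struct L C) s)"
      proof (rule inj_onI)
        fix u w assume "u \<in> univ (eq_struct L C) s" "w \<in> univ (eq_struct L C) s"
          and eq: "eq_map \<sigma> u = eq_map \<sigma> w"
        then obtain xs ys where xs: "u = Class n E (E `` {xs})" "xs \<in> tuples C n"
          and ys: "w = Class n E (E `` {ys})" "ys \<in> tuples C n"
          unfolding univ by blast
        have "E `` {map \<sigma> xs} = E `` {map \<sigma> ys}" using eq xs ys cls[OF E] by simp
        then have "(map \<sigma> xs, map \<sigma> ys) \<in> E"
          using eq_equiv_class[OF _ eqv] tup[OF ys(2)] by blast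
        then have "(xs, ys) \<in> E" using def_equiv_automorphism[OF L C \<sigma> E xs(2) ys(2)] by blast
        then show "u = w" using equiv_class_eq[OF eqv] xs ys by simp
      qed
      moreover have "eq_map \<sigma> ` univ (eq_struct L C) s = univ (eq_struct L C) s"
      proof -
        have "eq_map \<sigma> ` univ (eq_struct L C) s =
            (\<lambda>xs. Class n E (E `` {xs})) ` map \<sigma> ` tuples C n"
          unfolding univ image_image using cls[OF E] by (intro image_cong) auto
        then show ?thesis by (simp add: univ automorphism_tuples[OF \<sigma>])
      qed
      ultimately show ?thesis by (simp add: bij_betw_def)
    qed (auto simp: Quot bij_betw_def)
  qed
  fix us
  show "eq_map \<sigma> (fint (eq_struct L C) h us) = fint (eq_struct L C) h (map (eq_map \<sigma>) us)"
    if h: "h \<in> funs (eq_lang L C)"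
      and us: "list_all2 (\<lambda>x s. x \<in> univ (eq_struct L C) s) us (fdom (eq_lang L C) h)" for h
  proof (cases h)
    case (Old f)
    then obtain xs where xs: "us = map Real xs" "set xs \<subseteq> points C" "length xs = length (fdom L f)"
      using us by (auto simp: list_all2_Home)
    have "f \<in> funs L" using h Old by auto
    then have "\<sigma> (fint C f xs) = fint C f (map \<sigma> xs)"
      using \<sigma> xs unfolding automorphism_def list_all2_one_sorted by blast
    then show ?thesis by (simp add: Old xs comp_def)
  next
    case (Proj n E)
    have "replicate n Home = map (\<lambda>_. Home) (replicate n Home :: 'e eqsort list)" by simp
    then obtain xs where xs: "us = map Real xs" "set xs \<subseteq> points C" "length xs = n"
      using us unfolding Proj eq_lang_simps by (metis length_map length_replicate list_all2_Home)
    then have "xs \<in> tuples C n" by (simp add: tuples_def)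
    moreover have "def_equiv L C n E" using h Proj by auto
    ultimately show ?thesis using cls by (simp add: Proj xs comp_def)
  qed
  show "rint (eq_struct L C) r (map (eq_map \<sigma>) us) = rint (eq_struct L C) r us"
    if r: "r \<in> rels (eq_lang L C)"
      and us: "list_all2 (\<lambda>x s. x \<in> univ (eq_struct L C) s) us (rdom (eq_lang L C) r)" for r
  proof -
    obtain xs where xs: "us = map Real xs" "set xs \<subseteq> points C" "length xs = length (rdom L r)"
      using us by (auto simp: list_all2_Home)
    then have "rint C r (map \<sigma> xs) = rint C r xs"
      using \<sigma> r unfolding automorphism_def list_all2_one_sorted by auto
    then show ?thesis by (simp add: xs comp_def)
  qed
qed

lemma eq_map_comp: "eq_map (\<tau> \<circ> \<sigma>) x = eq_map \<tau> (eq_map \<sigma> x)"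
  by (cases x) (simp_all add: eq_map_def image_image)

section \<open>Imaginaries with representatives in a given set\<close>

text \<open>
  The imaginaries represented by tuples of elements of \<open>S\<close>, together with \<open>S\<close> itself.
\<close>

definition represented ::
  "('f, 'r, unit) lang \<Rightarrow> ('f, 'r, unit, 'e) struct \<Rightarrow> 'e set \<Rightarrow> 'e eqpoint set" where
  "represented L C S = Real ` S \<union>
     {Class n E (E `` {xs}) | n E xs. def_equiv L C n E \<and> length xs = n \<and> set xs \<subseteq> S}"

lemma eq_points_represented: "eq_points L C M = represented L C (points M)"
  unfolding eq_points_def represented_def tuples_def by auto

lemma represented_mono: "S \<subseteq> S' \<Longrightarrow> represented L C S \<subseteq> represented L C S'"
  unfolding represented_def by blast

lemma represented_cases:
  assumes "x \<in> represented L C S"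
  obtains (real) e where "e \<in> S" "x = Real e"
  | (cls) n E xs where "def_equiv L C n E" "length xs = n" "set xs \<subseteq> S"
      "x = Class n E (E `` {xs})"
  using assms unfolding represented_def by blast

lemma represented_finite:
  assumes "x \<in> represented L C S"
  obtains F where "F \<subseteq> S" "finite F" "x \<in> represented L C F"
  using assms
proof (cases rule: represented_cases)
  case (real e)
  then show thesis using that[of "{e}"] by (auto simp: represented_def)
next
  case (cls n E xs)
  then show thesis using that[of "set xs"] by (auto simp: represented_def)
qed

lemma represented_points:
  fixes C :: "('f, 'r, unit, 'e) struct"
  assumes "S \<subseteq> points C"
  shows "represented L C S \<subseteq> points (eq_struct L C)"
proof
  fix x assume "x \<in> represented L C S"
  then show "x \<in> points (eq_struct L C)"
  proof (cases rule: represented_cases)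
    case (real e)
    then have "x \<in> univ (eq_struct L C) Home" using assms by auto
    then show ?thesis unfolding points_def by blast
  next
    case (cls n E xs)
    then have "x \<in> univ (eq_struct L C) (Quot n E)" using assms by (auto simp: tuples_def)
    then show ?thesis unfolding points_def by blast
  qed
qed

lemma eq_map_represented:
  assumes L: "sorts L = {()}" and C: "is_struct L C" and \<sigma>: "automorphism L C \<sigma>"
    and S: "S \<subseteq> points C" and x: "x \<in> represented L C S"
  shows "eq_map \<sigma> x \<in> represented L C (\<sigma> ` S)"
  using x
proof (cases rule: represented_cases)
  case (real e)
  then show ?thesis by (auto simp: represented_def)
next
  case (cls n E xs)
  have "xs \<in> tuples C n" using cls S by (auto simp: tuples_def)
  then have "eq_map \<sigma> x = Class n E (E `` {map \<sigma> xs})"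
    unfolding cls by (rule eq_map_Class[OF L C \<sigma> cls(1)])
  moreover have "length (map \<sigma> xs) = n" "set (map \<sigma> xs) \<subseteq> \<sigma> ` S" using cls by auto
  ultimately show ?thesis unfolding represented_def using cls(1) by blast
qed

lemma eq_map_represented_fixed:
  assumes L: "sorts L = {()}" and C: "is_struct L C" and \<sigma>: "automorphism L C \<sigma>"
    and S: "S \<subseteq> points C" "\<And>e. e \<in> S \<Longrightarrow> \<sigma> e = e" and x: "x \<in> represented L C S"
  shows "eq_map \<sigma> x = x"
  using x
proof (cases rule: represented_cases)
  case (real e)
  then show ?thesis using S by simp
next
  case (cls n E xs)
  have "xs \<in> tuples C n" using cls S by (auto simp: tuples_def)
  then have "eq_map \<sigma> x = Class n E (E `` {map \<sigma> xs})"
    unfolding cls by (rule eq_map_Class[OF L C \<sigma> cls(1)])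
  moreover have "map \<sigma> xs = xs" using cls S by (intro map_idI) blast
  ultimately show ?thesis by (simp add: cls)
qed

text \<open>A represented imaginary is the value of a term at elements of the home sort.\<close>

lemma represented_term:
  fixes C :: "('f, 'r, unit, 'e) struct"
  assumes L: "sorts L = {()}" and S: "S \<subseteq> points C" and x: "x \<in> represented L C S"
  obtains t :: "(('f, 'e) eqfun, 'e eqsort) trm" and xs :: "'e list"
  where "wf_trm (eq_lang L C) t" "set xs \<subseteq> S"
    "fv_trm t \<subseteq> {(Home, i) | i. i < length xs}" "x \<in> univ (eq_struct L C) (sort_of (eq_lang L C) t)"
    "sort_of (eq_lang L C) t \<in> sorts (eq_lang L C)"
    "\<And>\<rho>. (\<And>i. i < length xs \<Longrightarrow> \<rho> (Home, i) = Real (xs ! i)) \<Longrightarrow> eval_trm (eq_struct L C) \<rho> t = x"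
  using x
proof (cases rule: represented_cases)
  case (real e)
  have "e \<in> points C" using real S by blast
  with real show thesis by (intro that[of "Var Home 0" "[e]"]) auto
next
  case (cls n E xs)
  define t :: "(('f, 'e) eqfun, 'e eqsort) trm" where "t = Fn (Proj n E) (map (Var Home) [0..<n])"
  show thesis
  proof (rule that[of t xs])
    show "wf_trm (eq_lang L C) t"
      using cls by (auto simp: t_def comp_def map_replicate_const)
    show "set xs \<subseteq> S" by (fact cls)
    show "fv_trm t \<subseteq> {(Home, i) | i. i < length xs}" using cls by (auto simp: t_def)
    show "x \<in> univ (eq_struct L C) (sort_of (eq_lang L C) t)"
      using cls S by (auto simp: t_def tuples_def)
    show "sort_of (eq_lang L C) t \<in> sorts (eq_lang L C)" using cls by (auto simp: t_def)
    fix \<rho> :: "'e eqsort \<times> nat \<Rightarrow> 'e eqpoint"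
    assume \<rho>: "\<And>i. i < length xs \<Longrightarrow> \<rho> (Home, i) = Real (xs ! i)"
    have "map the_real (map (eval_trm (eq_struct L C) \<rho>) (map (Var Home) [0..<n])) = xs"
      using cls \<rho> by (intro nth_equalityI) auto
    then show "eval_trm (eq_struct L C) \<rho> t = x" by (simp add: t_def cls(4))
  qed
qed

lemma tp_eqD:
  assumes tp: "tp L M B I a' = tp L M B I a" and wf: "wf_fm L \<phi>"
    and v: "\<And>s n. (s, n) \<in> fv \<phi> \<Longrightarrow> v (s, n) \<in> {i \<in> I. a i \<in> univ M s} <+> (B \<inter> univ M s)"
    and sat: "sat M (case_sum a id \<circ> v) \<phi>"
  shows "sat M (case_sum a' id \<circ> v) \<phi>"
    and "\<And>s n i. (s, n) \<in> fv \<phi> \<Longrightarrow> v (s, n) = Inl i \<Longrightarrow> a' i \<in> univ M s"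
proof -
  have "(\<phi>, v) \<in> tp L M B I a"
    using wf v sat by (auto simp: tp_def fms_over_def sat_over_def)
  then have "(\<phi>, v) \<in> tp L M B I a'" by (simp add: tp)
  then show "sat M (case_sum a' id \<circ> v) \<phi>"
    and "\<And>s n i. (s, n) \<in> fv \<phi> \<Longrightarrow> v (s, n) = Inl i \<Longrightarrow> a' i \<in> univ M s"
    by (force simp: tp_def fms_over_def sat_over_def)+
qed

text \<open>
  The type of a represented imaginary over its representatives contains the formula that says that
  it is the value of the representing term, hence has one realization.
\<close>

lemma represented_tp_fixed:
  fixes C :: "('f, 'r, unit, 'e) struct" and g :: "'e eqpoint \<Rightarrow> 'e eqpoint"
  assumes L: "sorts L = {()}" and S: "S \<subseteq> points C" and B: "Real ` S \<subseteq> B"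
    and tp: "tp (eq_lang L C) (eq_struct L C) B X g = tp (eq_lang L C) (eq_struct L C) B X id"
    and x: "x \<in> X" "x \<in> represented L C S"
  shows "g x = x"
proof -
  obtain t xs where t: "wf_trm (eq_lang L C) t" and xs: "set xs \<subseteq> S"
    and fv_t: "fv_trm t \<subseteq> {(Home, i) | i. i < length xs}"
    and x_univ: "x \<in> univ (eq_struct L C) (sort_of (eq_lang L C) t)"
    and srt: "sort_of (eq_lang L C) t \<in> sorts (eq_lang L C)"
    and eval: "\<And>\<rho>. (\<And>i. i < length xs \<Longrightarrow> \<rho> (Home, i) = Real (xs ! i)) \<Longrightarrow>
      eval_trm (eq_struct L C) \<rho> t = x"
    using represented_term[OF L S x(2)] by blast
  define s where "s = sort_of (eq_lang L C) t"
  \<comment> \<open>the index is fresh even when \<open>x\<close> is in the home sort\<close>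
  define \<phi> :: "(('f, 'e) eqfun, 'r, 'e eqsort) fm" where "\<phi> = Eq t (Var s (length xs))"
  define v where "v z = (if z = (s, length xs) then Inl x else Inr (Real (xs ! snd z)))"
    for z :: "'e eqsort \<times> nat"
  have ev: "eval_trm (eq_struct L C) (case_sum h id \<circ> v) t = x" for h
    by (rule eval) (simp add: v_def)
  have mem: "xs ! i \<in> S" if "i < length xs" for i using xs nth_mem[OF that] by blast
  have "sat (eq_struct L C) (case_sum g id \<circ> v) \<phi>"
  proof (rule tp_eqD(1)[OF tp])
    show "wf_fm (eq_lang L C) \<phi>" using t srt by (simp add: \<phi>_def s_def)
    show "sat (eq_struct L C) (case_sum id id \<circ> v) \<phi>" using ev[of id] by (simp add: \<phi>_def v_def)
    fix s' n assume "(s', n) \<in> fv \<phi>"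
    then have "(s', n) = (s, length xs) \<or> s' = Home \<and> n < length xs"
      using fv_t by (auto simp: \<phi>_def)
    then show "v (s', n) \<in> {i \<in> X. id i \<in> univ (eq_struct L C) s'} <+> (B \<inter> univ (eq_struct L C) s')"
      using x x_univ mem[of n] S B by (auto simp: v_def s_def)
  qed
  then show ?thesis using ev[of g] by (simp add: \<phi>_def v_def)
qed

text \<open>
  The same formula, with the roles of parameters and variables exchanged: if an elementary map over
  a represented imaginary agrees with an automorphism on the representatives, then the automorphism
  fixes the imaginary.
\<close>

lemma represented_automorphism_fixed:
  fixes C :: "('f, 'r, unit, 'e) struct" and g :: "'e eqpoint \<Rightarrow> 'e eqpoint"
  assumes L: "sorts L = {()}" and C: "is_struct L C" and \<sigma>: "automorphism L C \<sigma>"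
    and S: "S \<subseteq> points C" and A: "Real ` S \<subseteq> A"
    and tp: "tp (eq_lang L C) (eq_struct L C) B A g = tp (eq_lang L C) (eq_struct L C) B A id"
    and g: "\<And>e. e \<in> S \<Longrightarrow> g (Real e) = Real (\<sigma> e)"
    and x: "x \<in> B" "x \<in> represented L C S"
  shows "eq_map \<sigma> x = x"
proof -
  obtain t xs where t: "wf_trm (eq_lang L C) t" and xs: "set xs \<subseteq> S"
    and fv_t: "fv_trm t \<subseteq> {(Home, i) | i. i < length xs}"
    and x_univ: "x \<in> univ (eq_struct L C) (sort_of (eq_lang L C) t)"
    and srt: "sort_of (eq_lang L C) t \<in> sorts (eq_lang L C)"
    and eval: "\<And>\<rho>. (\<And>i. i < length xs \<Longrightarrow> \<rho> (Home, i) = Real (xs ! i)) \<Longrightarrow>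
      eval_trm (eq_struct L C) \<rho> t = x"
    using represented_term[OF L S x(2)] by blast
  define s where "s = sort_of (eq_lang L C) t"
  define \<phi> :: "(('f, 'e) eqfun, 'r, 'e eqsort) fm" where "\<phi> = Eq t (Var s (length xs))"
  define v where "v z = (if z = (s, length xs) then Inr x else Inl (Real (xs ! snd z)))"
    for z :: "'e eqsort \<times> nat"
  have ev: "eval_trm (eq_struct L C) (case_sum id id \<circ> v) t = x"
    by (rule eval) (simp add: v_def)
  have mem: "xs ! i \<in> S" if "i < length xs" for i using xs nth_mem[OF that] by blast
  have "sat (eq_struct L C) (case_sum g id \<circ> v) \<phi>"
  proof (rule tp_eqD(1)[OF tp])
    show "wf_fm (eq_lang L C) \<phi>" using t srt by (simp add: \<phi>_def s_def)
    show "sat (eq_struct L C) (case_sum id id \<circ> v) \<phi>" using ev by (simp add: \<phi>_def v_def)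
    fix s' n assume "(s', n) \<in> fv \<phi>"
    then have "(s', n) = (s, length xs) \<or> s' = Home \<and> n < length xs"
      using fv_t by (auto simp: \<phi>_def)
    then show "v (s', n) \<in> {i \<in> A. id i \<in> univ (eq_struct L C) s'} <+> (B \<inter> univ (eq_struct L C) s')"
      using x x_univ mem[of n] S A by (auto simp: v_def s_def)
  qed
  then have "eval_trm (eq_struct L C) (case_sum g id \<circ> v) t = x" by (simp add: \<phi>_def v_def)
  moreover have "eval_trm (eq_struct L C) (case_sum g id \<circ> v) t =
      eval_trm (eq_struct L C) (eq_map \<sigma> \<circ> (case_sum id id \<circ> v)) t"
    by (rule eval_trm_cong) (use fv_t mem g in \<open>auto simp: v_def\<close>)
  moreover have "\<dots> = eq_map \<sigma> (eval_trm (eq_struct L C) (case_sum id id \<circ> v) t)"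
  proof (rule automorphism_eval[THEN conjunct2])
    show "is_struct (eq_lang L C) (eq_struct L C)" by (rule eq_struct_is_struct[OF L C])
    show "automorphism (eq_lang L C) (eq_struct L C) (eq_map \<sigma>)"
      by (rule eq_map_automorphism[OF L C \<sigma>])
    show "wf_trm (eq_lang L C) t" by (rule t)
    fix s' n assume "(s', n) \<in> fv_trm t"
    then have "s' = Home" "n < length xs" using fv_t by auto
    then show "(case_sum id id \<circ> v) (s', n) \<in> univ (eq_struct L C) s'"
      using mem[of n] S by (auto simp: v_def)
  qed
  ultimately show ?thesis by (simp add: ev)
qed

section \<open>Home-sort formulas in the imaginary expansion\<close>

text \<open>Terms and formulas of the one-sorted language, read in the home sort.\<close>

primrec home_trm :: "('f, unit) trm \<Rightarrow> (('f, 'e) eqfun, 'e eqsort) trm" where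
  "home_trm (Var s n) = Var Home n"
| "home_trm (Fn f ts) = Fn (Old f) (map home_trm ts)"

primrec home_fm :: "('f, 'r, unit) fm \<Rightarrow> (('f, 'e) eqfun, 'r, 'e eqsort) fm" where
  "home_fm (Eq t u) = Eq (home_trm t) (home_trm u)"
| "home_fm (Rel r ts) = Rel r (map home_trm ts)"
| "home_fm (Neg \<phi>) = Neg (home_fm \<phi>)"
| "home_fm (Conj \<phi> \<psi>) = Conj (home_fm \<phi>) (home_fm \<psi>)"
| "home_fm (Ex s n \<phi>) = Ex Home n (home_fm \<phi>)"

lemma sort_of_home_trm [simp]: "sort_of (eq_lang L C) (home_trm t) = Home"
  by (cases t) simp_all

lemma wf_home_trm: "wf_trm L t \<Longrightarrow> wf_trm (eq_lang L C) (home_trm t)"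
proof (induction t)
  case (Fn f ts)
  have "map (sort_of (eq_lang L C)) (map home_trm ts) = map (\<lambda>_. Home) (map (sort_of L) ts)"
    by simp
  with Fn show ?case by (auto simp: comp_def)
qed simp

lemma wf_home_fm: "wf_fm L \<phi> \<Longrightarrow> wf_fm (eq_lang L C) (home_fm \<phi>)"
proof (induction \<phi>)
  case (Rel r ts)
  have "map (sort_of (eq_lang L C)) (map home_trm ts) = map (\<lambda>_. Home) (map (sort_of L) ts)"
    by simp
  with Rel show ?case by (auto simp: comp_def wf_home_trm)
qed (auto simp: wf_home_trm)

lemma fv_home_trm: "fv_trm (home_trm t) = (\<lambda>(_, n). (Home, n)) ` fv_trm t"
  by (induction t) auto

lemma fv_home_fm: "fv (home_fm \<phi>) = (\<lambda>(_, n). (Home, n)) ` fv \<phi>"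
  by (induction \<phi>) (auto simp: fv_home_trm)

lemma eval_home_trm:
  "(\<And>n. \<rho>' (Home, n) = Real (\<rho> ((), n))) \<Longrightarrow>
    eval_trm (eq_struct L C) \<rho>' (home_trm t) = Real (eval_trm C \<rho> t)"
proof (induction t)
  case (Fn f ts)
  then have "map the_real (map (eval_trm (eq_struct L C) \<rho>') (map home_trm ts)) =
      map (eval_trm C \<rho>) ts"
    by simp
  then show ?case by (simp del: map_map)
qed simp

lemma sat_home_fm:
  "(\<And>n. \<rho>' (Home, n) = Real (\<rho> ((), n))) \<Longrightarrow>
    sat (eq_struct L C) \<rho>' (home_fm \<phi>) \<longleftrightarrow> sat C \<rho> \<phi>"
proof (induction \<phi> arbitrary: \<rho> \<rho>')
  case (Eq t u)
  then show ?case using eval_home_trm[of \<rho>' \<rho> L C] by simp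
next
  case (Rel r ts)
  have "map the_real (map (eval_trm (eq_struct L C) \<rho>') (map home_trm ts)) = map (eval_trm C \<rho>) ts"
    using eval_home_trm[of \<rho>' \<rho> L C] Rel by simp
  then show ?case by (simp del: map_map)
next
  case (Ex s n \<phi>)
  have "sat (eq_struct L C) (\<rho>'((Home, n) := Real e)) (home_fm \<phi>) \<longleftrightarrow>
      sat C (\<rho>((s, n) := e)) \<phi>" for e
    by (rule Ex.IH) (use Ex.prems in auto)
  then show ?case by (simp add: points_one_sorted[of C s])
qed auto

text \<open>
  The parameters in \<open>B\<close> play no role: the graph is elementary over the empty set only, and what it
  does to imaginary parameters is recovered in \<open>represented_automorphism_fixed\<close>.
\<close>

lemma tp_eq_partial_elementary:
  fixes C :: "('f, 'r, unit, 'e) struct" and g :: "'e eqpoint \<Rightarrow> 'e eqpoint"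
  assumes S: "S \<subseteq> points C"
    and tp: "tp (eq_lang L C) (eq_struct L C) B (Real ` S) g =
      tp (eq_lang L C) (eq_struct L C) B (Real ` S) id"
  shows "\<And>e. e \<in> S \<Longrightarrow> g (Real e) \<in> Real ` points C"
    and "partial_elementary L C {(e, e'). e \<in> S \<and> g (Real e) = Real e'}"
proof -
  show home: "g (Real e) \<in> Real ` points C" if e: "e \<in> S" for e
  proof -
    define \<phi> :: "(('f, 'e) eqfun, 'r, 'e eqsort) fm" where "\<phi> = Eq (Var Home 0) (Var Home 0)"
    have "g (Real e) \<in> univ (eq_struct L C) Home"
    proof (rule tp_eqD(2)[OF tp])
      show "wf_fm (eq_lang L C) \<phi>" by (simp add: \<phi>_def)
      show "(Home, 0) \<in> fv \<phi>" by (simp add: \<phi>_def)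
      show "(\<lambda>_. Inl (Real e)) (Home, 0) = Inl (Real e)" by simp
    qed (use e S in \<open>auto simp: \<phi>_def\<close>)
    then show ?thesis by simp
  qed
  define G where "G = {(e, e'). e \<in> S \<and> g (Real e) = Real e'}"
  have imp: "sat C \<rho>' \<phi>"
    if wf: "wf_fm L \<phi>" and \<rho>: "\<And>x. x \<in> fv \<phi> \<Longrightarrow> (\<rho> x, \<rho>' x) \<in> G" and sat: "sat C \<rho> \<phi>"
    for \<phi> \<rho> \<rho>'
  proof -
    define v where "v z = (Inl (Real (\<rho> ((), snd z))) :: 'e eqpoint + 'e eqpoint)"
      for z :: "'e eqsort \<times> nat"
    define \<rho>g where "\<rho>g z = the_real (g (Real (\<rho> z)))" for z
    define w where "w z = Real (\<rho>g ((), snd z))" for z :: "'e eqsort \<times> nat"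
    have "sat (eq_struct L C) (case_sum g id \<circ> v) (home_fm \<phi>)"
    proof (rule tp_eqD(1)[OF tp wf_home_fm[OF wf]])
      show "sat (eq_struct L C) (case_sum id id \<circ> v) (home_fm \<phi>)"
        using sat sat_home_fm[of "case_sum id id \<circ> v" \<rho> L C] by (simp add: v_def)
      fix s n assume "(s, n) \<in> fv (home_fm \<phi> :: (('f, 'e) eqfun, 'r, 'e eqsort) fm)"
      then have "s = Home" "((), n) \<in> fv \<phi>" by (auto simp: fv_home_fm)
      moreover from this have "\<rho> ((), n) \<in> S" using \<rho> by (auto simp: G_def)
      ultimately show "v (s, n) \<in> {i \<in> Real ` S. id i \<in> univ (eq_struct L C) s} <+>
          (B \<inter> univ (eq_struct L C) s)"
        using S by (auto simp: v_def)
    qed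
    also have "?this \<longleftrightarrow> sat (eq_struct L C) w (home_fm \<phi>)"
    proof (rule sat_cong)
      fix z assume "z \<in> fv (home_fm \<phi> :: (('f, 'e) eqfun, 'r, 'e eqsort) fm)"
      then obtain n where n: "z = (Home, n)" "((), n) \<in> fv \<phi>" by (auto simp: fv_home_fm)
      then have "g (Real (\<rho> ((), n))) = Real (\<rho>' ((), n))" using \<rho> by (auto simp: G_def)
      then show "(case_sum g id \<circ> v) z = w z" by (simp add: v_def w_def \<rho>g_def n)
    qed
    also have "\<dots> \<longleftrightarrow> sat C \<rho>g \<phi>" by (rule sat_home_fm) (simp add: w_def)
    also have "\<dots> \<longleftrightarrow> sat C \<rho>' \<phi>"
      by (rule sat_cong) (use \<rho> in \<open>force simp: \<rho>g_def G_def\<close>)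
    finally show ?thesis .
  qed
  have "sat C \<rho> \<phi> \<longleftrightarrow> sat C \<rho>' \<phi>"
    if "wf_fm L \<phi>" and "\<And>x. x \<in> fv \<phi> \<Longrightarrow> (\<rho> x, \<rho>' x) \<in> G" for \<phi> \<rho> \<rho>'
    using imp[of \<phi> \<rho> \<rho>'] imp[of "Neg \<phi>" \<rho> \<rho>'] that by auto
  moreover have "G \<subseteq> points C \<times> points C" using S home by (force simp: G_def)
  ultimately show "partial_elementary L C {(e, e'). e \<in> S \<and> g (Real e) = Real e'}"
    unfolding partial_elementary_def G_def[symmetric] by blast
qed

section \<open>The extension property for imaginary tuples\<close>

lemma represented_family:
  assumes k: "Cinfinite k" and I: "|I| <o k" and c: "c ` I \<subseteq> represented L C S"
  obtains b where "b \<subseteq> S" "|b| <o k" "c ` I \<subseteq> represented L C b"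
proof -
  have "\<exists>F. F \<subseteq> S \<and> finite F \<and> c i \<in> represented L C F" if "i \<in> I" for i
  proof -
    have "c i \<in> represented L C S" using c that by blast
    then show ?thesis by (rule represented_finite) blast
  qed
  then obtain F where F: "\<And>i. i \<in> I \<Longrightarrow> F i \<subseteq> S \<and> finite (F i) \<and> c i \<in> represented L C (F i)"
    by metis
  define b where "b = (\<Union>i\<in>I. F i)"
  have "|b| <o k"
  proof (cases "finite I")
    case True
    then have "finite b" using F by (auto simp: b_def)
    then show ?thesis
      using k by (auto simp: cinfinite_def Field_card_of card_of_card_order_on
          intro!: finite_ordLess_infinite card_order_on_well_order_on)
  next
    case False
    have "|b| \<le>o |I|" unfolding b_def
    proof (rule card_of_UNION_ordLeq_infinite[OF False])
      show "|I| \<le>o |I|" by (rule ordLeq_refl) (rule card_of_Card_order)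
      show "\<forall>i\<in>I. |F i| \<le>o |I|"
        using F False by (auto simp: Field_card_of card_of_card_order_on
            intro!: ordLess_imp_ordLeq finite_ordLess_infinite card_order_on_well_order_on)
    qed
    then show ?thesis using I by (rule ordLeq_ordLess_trans)
  qed
  moreover have "b \<subseteq> S" using F by (auto simp: b_def)
  moreover have "c ` I \<subseteq> represented L C b"
  proof
    fix u assume "u \<in> c ` I"
    then obtain i where i: "i \<in> I" "u = c i" by blast
    have "F i \<subseteq> b" using i by (auto simp: b_def)
    from represented_mono[OF this] show "u \<in> represented L C b" using F i by blast
  qed
  ultimately show thesis using that by blast
qed

theorem lemma5p6:
  fixes L :: "('f, 'r, unit) lang"
    and T :: "('f, 'r, unit) fm set"
    and C :: "('f, 'r, unit, 'e) struct"
    and kbar k0 k :: "'k rel"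
    and ind :: "'e set \<Rightarrow> 'e set \<Rightarrow> 'e set \<Rightarrow> bool"
    and ind_eq :: "'e eqpoint set \<Rightarrow> 'e eqpoint set \<Rightarrow> 'e eqpoint set \<Rightarrow> bool"
    and MP :: "('f, 'r option, unit, 'e) struct"
    and c :: "'i \<Rightarrow> 'e eqpoint" and I :: "'i set"
    and a :: "'j \<Rightarrow> 'e eqpoint" and J :: "'j set"
  assumes "sorts L = {()}"
    and "complete_theory L T"
    and "monster L C kbar"
    and "models C T"
    and "independence_relation L C kbar ind"
    and "is_kappa0 C kbar ind k0"
    and "Card_order k" and "k <o kbar" and "k0 <o k" and "|T| <o k"
    and "independence_relation (eq_lang L C) (eq_struct L C) kbar ind_eq"
    and "extends_ind C kbar ind_eq ind"
    and "pair_model L T C MP"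
    and "|points MP| <o kbar"
    and "cl C ind (Ppart MP) \<inter> points MP = Ppart MP"
    and "extension_property L C k ind MP"
    and "|I| <o k" and "c ` I \<subseteq> eq_points L C (reduct MP)"
    and "|J| <o k" and "a ` J \<subseteq> eq_points L C (reduct MP)"
  shows "\<exists>c'. c' ` I \<subseteq> eq_points L C (reduct MP) \<and>
           tp (eq_lang L C) (eq_struct L C) (a ` J) I c' =
           tp (eq_lang L C) (eq_struct L C) (a ` J) I c \<and>
           ind_eq (c' ` I) (a ` J) (Real ` Ppart MP)"
proof -
  note L = assms(1) and mon = assms(3) and k_kbar = assms(8) and ext = assms(16)
  have C: "is_struct L C" using mon by (simp add: monster_def)
  have k: "Cinfinite k"
    using assms(6,7,9) cinfinite_mono ordLess_imp_ordLeq unfolding is_kappa0_def by blast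
  have kbar: "Cinfinite kbar"
    using k k_kbar mon cinfinite_mono ordLess_imp_ordLeq unfolding monster_def by blast
  have real: "independence L C kbar ind" using assms(5) kbar by unfold_locales
  interpret im: independence "eq_lang L C" "eq_struct L C" kbar ind_eq
    using assms(11) kbar by unfold_locales
  have M_C: "points MP \<subseteq> points C"
    using assms(13) unfolding pair_model_def elementary_substructure_def points_def reduct_def by auto
  have M_eq: "eq_points L C (reduct MP) = represented L C (points MP)"
    unfolding eq_points_represented by (simp add: points_def reduct_def)
  have P: "Ppart MP \<subseteq> points MP" unfolding Ppart_def by blast
  have small_M: "small_subset kbar C X" if "X \<subseteq> points MP" for X
    using that M_C ordLeq_ordLess_trans[OF card_of_mono1[OF that] assms(14)]
    unfolding small_subset_def by blast
  have small_k: "small_subset kbar C X" if "X \<subseteq> points C" "|X| <o k" for X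
    using that ordLess_transitive[OF that(2) k_kbar] unfolding small_subset_def by blast
  have small_Real: "im.small (Real ` X)" if "small_subset kbar C X" for X
  proof -
    have "Real ` X \<subseteq> represented L C X" by (auto simp: represented_def)
    then have "Real ` X \<subseteq> points (eq_struct L C)"
      using represented_points[of X C L] that unfolding small_subset_def by blast
    then show ?thesis
      using that ordLeq_ordLess_trans[OF card_of_image] unfolding small_subset_def by blast
  qed

  obtain b where b: "b \<subseteq> points MP" "|b| <o k" "c ` I \<subseteq> represented L C b"
    using represented_family[OF k assms(17)] assms(18) unfolding M_eq by blast
  obtain d where d: "d \<subseteq> points MP" "|d| <o k" "a ` J \<subseteq> represented L C d"
    using represented_family[OF k assms(19)] assms(20) unfolding M_eq by blast
  have bd_C: "b \<union> d \<subseteq> points C" and b_C: "b \<subseteq> points C" and d_C: "d \<subseteq> points C"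
    using b d M_C by auto
  have small_repr: "im.small (h ` K)" if "h ` K \<subseteq> represented L C S" "S \<subseteq> points C" "|K| <o k"
    for h and K :: "'x set" and S
    using that represented_points[OF that(2), of L]
      ordLeq_ordLess_trans[OF card_of_image[of h K] ordLess_transitive[OF that(3) k_kbar]]
    unfolding small_subset_def by blast
  have small_a: "im.small (a ` J)" by (rule small_repr[OF d(3) d_C assms(19)])

  \<comment> \<open>\<open>d\<close> is moved along with \<open>b\<close>: the images of the representatives determine that of \<open>a\<close>,
    so the automorphism extending the home-sort part of \<open>g\<close> fixes \<open>a\<close>\<close>
  obtain g where
    g_tp: "tp (eq_lang L C) (eq_struct L C) (a ` J) (Real ` (b \<union> d)) g =
      tp (eq_lang L C) (eq_struct L C) (a ` J) (Real ` (b \<union> d)) id"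
    and g_ind: "ind_eq (g ` Real ` (b \<union> d)) (a ` J) (Real ` d)"
    by (rule im.extension[of "Real ` (b \<union> d)" "a ` J" "Real ` d"])
      (use small_a small_Real small_M b d in auto)
  define G where "G = {(e, e'). e \<in> b \<union> d \<and> g (Real e) = Real e'}"
  have pe: "partial_elementary L C G"
    using tp_eq_partial_elementary(2)[OF bd_C g_tp] by (simp add: G_def)
  have "Domain G \<subseteq> points MP" using b d by (auto simp: G_def)
  then have "|Domain G| <o kbar" using small_M unfolding small_subset_def by blast
  then obtain \<sigma> where \<sigma>: "automorphism L C \<sigma>" and \<sigma>G: "\<And>e e'. (e, e') \<in> G \<Longrightarrow> \<sigma> e = e'"
    using partial_elementary_automorphism[OF L mon pe] by blast
  have g_\<sigma>: "g (Real e) = Real (\<sigma> e)" if e: "e \<in> b \<union> d" for e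
  proof -
    obtain e' where e': "g (Real e) = Real e'"
      using tp_eq_partial_elementary(1)[OF bd_C g_tp e] by blast
    then show ?thesis using e \<sigma>G[of e e'] by (simp add: G_def)
  qed
  have \<sigma>_a: "eq_map \<sigma> x = x" if x: "x \<in> a ` J" for x
  proof (rule represented_automorphism_fixed[OF L C \<sigma> d_C _ g_tp _ x])
    show "Real ` d \<subseteq> Real ` (b \<union> d)" by blast
    show "g (Real e) = Real (\<sigma> e)" if "e \<in> d" for e using g_\<sigma> that by blast
    show "x \<in> represented L C d" using x d(3) by blast
  qed

  \<comment> \<open>\<open>\<sigma> b\<close> is moved into the pair over \<open>d\<close>\<close>
  have \<sigma>b_C: "\<sigma> ` b \<subseteq> points C"
    using \<sigma> b_C unfolding points_one_sorted[of C "()"] automorphism_def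
    by (blast dest: bij_betwE)
  have \<sigma>b_k: "|\<sigma> ` b| <o k" by (rule ordLeq_ordLess_trans[OF card_of_image b(2)])
  obtain \<tau> where \<tau>: "automorphism L C \<tau>" and \<tau>_d: "\<And>x. x \<in> d \<Longrightarrow> \<tau> x = x"
    and \<tau>_M: "\<tau> ` \<sigma> ` b \<subseteq> points MP" and \<tau>_ind: "ind (\<tau> ` \<sigma> ` b) d (Ppart MP)"
    by (rule extension_property_tuples[OF L mon real k k_kbar ext M_C assms(14) d(1,2) \<sigma>b_C \<sigma>b_k])
      blast
  have \<tau>_a: "eq_map \<tau> x = x" if x: "x \<in> a ` J" for x
    using eq_map_represented_fixed[OF L C \<tau> d_C \<tau>_d] d(3) x by blast
  define b' where "b' = \<tau> ` \<sigma> ` b"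
  have b': "b' \<subseteq> points MP" "b' \<subseteq> points C" using \<tau>_M M_C by (auto simp: b'_def)
  have small_b': "im.small (Real ` b')" and small_d: "im.small (Real ` d)"
    and small_P: "im.small (Real ` Ppart MP)" and small_\<sigma>b: "im.small (Real ` \<sigma> ` b)"
    by (intro small_Real small_M b' d P) (intro small_Real small_M b' d P small_k \<sigma>b_C \<sigma>b_k)+
  have a_rigid: "im.rigid (Real ` d \<union> Real ` Ppart MP) (a ` J)"
    unfolding im.rigid_def
  proof (intro allI impI ballI)
    fix h x
    assume h: "tp (eq_lang L C) (eq_struct L C) (Real ` d \<union> Real ` Ppart MP) (a ` J) h =
        tp (eq_lang L C) (eq_struct L C) (Real ` d \<union> Real ` Ppart MP) (a ` J) id"
      and x: "x \<in> a ` J"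
    show "h x = x" by (rule represented_tp_fixed[OF L d_C _ h x]) (use x d(3) in blast)+
  qed
  \<comment> \<open>independence of \<open>\<sigma> b\<close> from \<open>d\<close> over \<open>a\<close>, transported along \<open>\<tau>\<close>\<close>
  have "ind_eq (Real ` b') (a ` J) (Real ` d)"
  proof -
    have "g ` Real ` (b \<union> d) = Real ` \<sigma> ` (b \<union> d)"
      unfolding image_image using g_\<sigma> by (rule image_cong[OF refl])
    with g_ind have bd_ind: "ind_eq (Real ` \<sigma> ` (b \<union> d)) (a ` J) (Real ` d)" by simp
    have small_bd: "im.small (Real ` \<sigma> ` (b \<union> d))"
    proof (intro small_Real small_k)
      show "\<sigma> ` (b \<union> d) \<subseteq> points C"
        using \<sigma> bd_C unfolding points_one_sorted[of C "()"] automorphism_def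
        by (blast dest: bij_betwE)
      have "|b \<union> d| <o k"
        using k b(2) d(2) card_of_Un_ordLess_infinite_Field[of k b d] by (auto simp: cinfinite_def)
      then show "|\<sigma> ` (b \<union> d)| <o k" by (rule ordLeq_ordLess_trans[OF card_of_image])
    qed
    have "ind_eq (Real ` \<sigma> ` b) (a ` J) (Real ` d)"
      by (rule im.mono_left[OF bd_ind _ small_bd small_a small_d]) blast
    then have "ind_eq (eq_map \<tau> ` Real ` \<sigma> ` b) (eq_map \<tau> ` a ` J) (eq_map \<tau> ` Real ` d)"
      by (intro im.invariance small_\<sigma>b small_a small_d eq_map_automorphism[OF L C \<tau>])
    moreover have "eq_map \<tau> ` a ` J = a ` J" using \<tau>_a by (auto simp: image_iff)
    moreover have "\<tau> ` d = d" using \<tau>_d by simp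
    ultimately show ?thesis by (simp add: eq_map_image_Real b'_def)
  qed
  moreover have "ind_eq (Real ` b') (Real ` d) (Real ` Ppart MP)"
    using assms(12) \<tau>_ind small_M[OF b'(1)] small_M[OF d(1)] small_M[OF P]
    unfolding extends_ind_def b'_def by blast
  ultimately have b'_ind: "ind_eq (Real ` b') (a ` J) (Real ` Ppart MP)"
    by (rule im.ind_replace_base) (intro a_rigid small_b' small_a small_P small_d)+

  define \<nu> where "\<nu> = \<tau> \<circ> \<sigma>"
  have \<nu>: "automorphism L C \<nu>" unfolding \<nu>_def by (rule automorphism_comp[OF \<sigma> \<tau>])
  define c' where "c' = eq_map \<nu> \<circ> c"
  have c'_b': "c' ` I \<subseteq> represented L C b'"
  proof
    fix u assume "u \<in> c' ` I"
    then obtain i where i: "i \<in> I" "u = eq_map \<nu> (c i)" by (auto simp: c'_def)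
    then have "u \<in> represented L C (\<nu> ` b)"
      using eq_map_represented[OF L C \<nu> b_C, of "c i"] b(3) by blast
    then show "u \<in> represented L C b'" by (simp add: \<nu>_def b'_def image_comp)
  qed
  have "c' ` I \<subseteq> eq_points L C (reduct MP)"
    unfolding M_eq using c'_b' represented_mono[OF b'(1)] by (rule subset_trans)
  moreover have "tp (eq_lang L C) (eq_struct L C) (a ` J) I c' =
      tp (eq_lang L C) (eq_struct L C) (a ` J) I c"
    unfolding c'_def
  proof (rule tp_automorphism[OF eq_struct_is_struct[OF L C] eq_map_automorphism[OF L C \<nu>]])
    show "eq_map \<nu> x = x" if "x \<in> a ` J" for x
      by (simp add: \<nu>_def eq_map_comp \<sigma>_a[OF that] \<tau>_a[OF that])
    show "c ` I \<subseteq> points (eq_struct L C)" using b(3) represented_points[OF b_C] by blast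
  qed
  moreover have "ind_eq (c' ` I) (a ` J) (Real ` Ppart MP)"
  proof (rule im.ind_rigid_left[OF b'_ind])
    show "im.rigid (a ` J \<union> Real ` b') (c' ` I)"
      unfolding im.rigid_def
    proof (intro allI impI ballI)
      fix h x
      assume h: "tp (eq_lang L C) (eq_struct L C) (a ` J \<union> Real ` b') (c' ` I) h =
          tp (eq_lang L C) (eq_struct L C) (a ` J \<union> Real ` b') (c' ` I) id"
        and x: "x \<in> c' ` I"
      show "h x = x" by (rule represented_tp_fixed[OF L b'(2) _ h x]) (use x c'_b' in blast)+
    qed
    show "im.small (c' ` I)" by (rule small_repr[OF c'_b' b'(2) assms(17)])
  qed (rule small_b' small_a small_P)+
  ultimately show ?thesis by blast
qed

end
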